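(* Let $(X_n)_n$ be a sequence of Banach spaces. Let either $X=(\sum_{n=1}^{\infty}\oplus X_n)_p$ with $1<p<\infty$ and $p^{*}$ the conjugate exponent of $p$, or $X=(\sum_{n=1}^{\infty}\oplus X_n)_0$, in which case put $p^{*}=1$. The following are equivalent for a bounded subset $A$ of $X^{*}$: (1) $A$ is a $p^{*}$-$(V)$ set; (2) $P_n(A)$ is a $p^{*}$-$(V)$ set for each $n\in\mathbb{N}$ and $$\lim_{n\to\infty}\sup\Big\{\sum_{k=n}^{\infty}\|P_k x^{*}\|^{p^{*}}: x^{*}\in A\Big\}=0.$$
   Context: For $1\le r<\infty$, a sequence $(x_n)_n$ in a Banach space $X$ is weakly $r$-summable if $\sum_n|\langle x^{*},x_n\rangle|^r<\infty$ for all $x^{*}\in X^{*}$. A bounded subset $K$ of $X^{*}$ is an $r$-$(V)$ set if $\lim_n\sup_{x^{*}\in K}|\langle x^{*},x_n\rangle|=0$ for every weakly $r$-summable sequence $(x_n)_n$ in $X$. $(\sum_{n}\oplus X_n)_p$ ($1\le p<\infty$) is the Banach space of all $x=(x_n)_n$ with $x_n\in X_n$ and $\|x\|=(\sum_n\|x_n\|^p)^{1/p}<\infty$; $(\sum_n\oplus X_n)_0$ is the space of all $x=(x_n)_n$ with $x_n\in X_n$ and $\lim_n\|x_n\|=0$, with the supremum norm. The dual $X^{*}$ is identified with $(\sum_n\oplus X_n^{*})_{p^{*}}$ (with $p^*=1$ in the case of $(\cdot)_0$), and $P_n:X^{*}\to X_n^{*}$ denotes the canonical coordinate projection, i.e.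 the adjoint of the canonical injection $I_n:X_n\to X$. *)

theory Defs
  imports "HOL-Analysis.Analysis" "HOL-Algebra.Algebraic_Closure_Type"
begin

text \<open>Frees the name \<open>X\<close>.\<close>

no_notation Polynomials.var (\<open>X\<index>\<close>)

text \<open>
  The spaces \<open>X\<^sub>n\<close> vary with \<open>n\<close>, so Banach spaces are structures with an explicit carrier
  and explicit operations: modules in the sense of \<open>HOL-Algebra\<close>, extended by a norm. The
  multiplicative fields that \<open>HOL-Algebra\<close>'s module record inherits from the ring record are
  not used.

  The scalars form a complete normed field \<open>'k :: {real_normed_field, banach}\<close>, which covers
  the real and the complex case at once.
\<close>

record ('k, 'a) normed_module = "('k, 'a) module" +
  vnorm :: "'a \<Rightarrow> real"

locale normed_space_on =
  module "ring_of_type_algebra :: 'k ring" E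
  for E :: "('k :: {real_normed_field, banach}, 'a) normed_module" (structure) +
  assumes vnorm_nonneg: "x \<in> carrier E \<Longrightarrow> 0 \<le> vnorm E x"
    and vnorm_eq_zero: "x \<in> carrier E \<Longrightarrow> vnorm E x = 0 \<longleftrightarrow> x = \<zero>\<^bsub>E\<^esub>"
    and vnorm_smult: "x \<in> carrier E \<Longrightarrow> vnorm E (a \<odot>\<^bsub>E\<^esub> x) = norm a * vnorm E x"
    and vnorm_triangle: "x \<in> carrier E \<Longrightarrow> y \<in> carrier E \<Longrightarrow>
      vnorm E (x \<oplus>\<^bsub>E\<^esub> y) \<le> vnorm E x + vnorm E y"

text \<open>The locale \<open>Metric_space\<close> requires nonnegativity and symmetry on the whole type, hence the
  value 0 outside the carrier.\<close>

definition vdist :: "('k, 'a) normed_module \<Rightarrow> 'a \<Rightarrow> 'a \<Rightarrow> real" where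
  "vdist X x y = (if x \<in> carrier X \<and> y \<in> carrier X then vnorm X (x \<ominus>\<^bsub>X\<^esub> y) else 0)"

locale banach_space_on = normed_space_on +
  assumes complete: "Metric_space.mcomplete (carrier E) (vdist E)"


text \<open>Functionals are made extensional, so that elements of the dual space are determined by
  their values on the carrier.\<close>

definition dual_space ::
  "('k :: {real_normed_field, banach}, 'a) normed_module \<Rightarrow> ('a \<Rightarrow> 'k) set" where
  "dual_space X = {f \<in> extensional (carrier X).
     (\<forall>x\<in>carrier X. \<forall>y\<in>carrier X. f (x \<oplus>\<^bsub>X\<^esub> y) = f x + f y) \<and>
     (\<forall>a. \<forall>x\<in>carrier X. f (a \<odot>\<^bsub>X\<^esub> x) = a * f x) \<and>
     (\<exists>C. \<forall>x\<in>carrier X. norm (f x) \<le> C * vnorm X x)}"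

definition dual_norm ::
  "('k :: {real_normed_field, banach}, 'a) normed_module \<Rightarrow> ('a \<Rightarrow> 'k) \<Rightarrow> real" where
  "dual_norm X f = (SUP x\<in>{x \<in> carrier X. vnorm X x \<le> 1}. norm (f x))"

definition dual_bounded ::
  "('k :: {real_normed_field, banach}, 'a) normed_module \<Rightarrow> ('a \<Rightarrow> 'k) set \<Rightarrow> bool" where
  "dual_bounded X K \<longleftrightarrow> K \<subseteq> dual_space X \<and> (\<exists>C. \<forall>f\<in>K. dual_norm X f \<le> C)"

definition adjoint_on :: "('k, 'a) normed_module \<Rightarrow> ('a \<Rightarrow> 'b) \<Rightarrow> ('b \<Rightarrow> 'k) \<Rightarrow> 'a \<Rightarrow> 'k" where
  "adjoint_on X T f = (\<lambda>x\<in>carrier X. f (T x))"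


definition weakly_summable ::
  "real \<Rightarrow> ('k :: {real_normed_field, banach}, 'a) normed_module \<Rightarrow> (nat \<Rightarrow> 'a) \<Rightarrow> bool" where
  "weakly_summable r X x \<longleftrightarrow> (\<forall>n. x n \<in> carrier X) \<and>
     (\<forall>f\<in>dual_space X. summable (\<lambda>n. norm (f (x n)) powr r))"

text \<open>The supremum is taken in \<^typ>\<open>ennreal\<close>, so that it is 0 for \<open>K = {}\<close>.\<close>

definition V_set ::
  "real \<Rightarrow> ('k :: {real_normed_field, banach}, 'a) normed_module \<Rightarrow> ('a \<Rightarrow> 'k) set \<Rightarrow> bool" where
  "V_set r X K \<longleftrightarrow> dual_bounded X K \<and>
     (\<forall>x. weakly_summable r X x \<longrightarrow>
        (\<lambda>n. SUP f\<in>K. ennreal (norm (f (x n)))) \<longlonglongrightarrow> 0)"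


definition pointwise_space ::
  "(nat \<Rightarrow> ('k, 'a) normed_module) \<Rightarrow> (nat \<Rightarrow> 'a) set \<Rightarrow> ((nat \<Rightarrow> 'a) \<Rightarrow> real)
     \<Rightarrow> ('k, nat \<Rightarrow> 'a) normed_module" where
  "pointwise_space X C N =
     \<lparr>carrier = C, mult = undefined, one = undefined,
      zero = (\<lambda>n. \<zero>\<^bsub>X n\<^esub>), add = (\<lambda>x y n. x n \<oplus>\<^bsub>X n\<^esub> y n),
      smult = (\<lambda>a x n. a \<odot>\<^bsub>X n\<^esub> x n), vnorm = N\<rparr>"

definition lp_sum ::
  "real \<Rightarrow> (nat \<Rightarrow> ('k, 'a) normed_module) \<Rightarrow> ('k, nat \<Rightarrow> 'a) normed_module" where
  "lp_sum p X = pointwise_space X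
     {x. (\<forall>n. x n \<in> carrier (X n)) \<and> summable (\<lambda>n. vnorm (X n) (x n) powr p)}
     (\<lambda>x. (\<Sum>n. vnorm (X n) (x n) powr p) powr (1 / p))"

definition c0_sum ::
  "(nat \<Rightarrow> ('k, 'a) normed_module) \<Rightarrow> ('k, nat \<Rightarrow> 'a) normed_module" where
  "c0_sum X = pointwise_space X
     {x. (\<forall>n. x n \<in> carrier (X n)) \<and> (\<lambda>n. vnorm (X n) (x n)) \<longlonglongrightarrow> 0}
     (\<lambda>x. SUP n. vnorm (X n) (x n))"

definition coord_inj :: "(nat \<Rightarrow> ('k, 'a) normed_module) \<Rightarrow> nat \<Rightarrow> 'a \<Rightarrow> nat \<Rightarrow> 'a" where
  "coord_inj X n x = (\<lambda>k. if k = n then x else \<zero>\<^bsub>X k\<^esub>)"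

definition coord_proj ::
  "(nat \<Rightarrow> ('k, 'a) normed_module) \<Rightarrow> nat \<Rightarrow> ((nat \<Rightarrow> 'a) \<Rightarrow> 'k) \<Rightarrow> 'a \<Rightarrow> 'k" where
  "coord_proj X n = adjoint_on (X n) (coord_inj X n)"

end

theory Submission
  imports Defs
begin

text \<open>
  Write \<open>d\<^sub>k f\<close> for the norm of the \<open>k\<close>-th coordinate \<open>P\<^sub>k f\<close> of a functional \<open>f\<close> on the
  direct sum \<open>Y\<close>. The proof rests on two estimates that together express the duality between \<open>Y\<close>
  and the \<open>q\<close>-sum of the dual spaces. If all finite sums of \<open>(d\<^sub>k f)\<^sup>q\<close> over a set \<open>S\<close> of
  indices are at most \<open>D\<^sup>q\<close>, then cutting off \<open>x\<close> outside \<open>S\<close> makes \<open>f\<close> at most \<open>D\<close> times the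
  norm of \<open>x\<close> (lemma \<open>dual_cutoff_le\<close>, from Hoelder's inequality). Conversely, if \<open>f\<close> is at most \<open>C\<close>
  on the vectors of norm at most one supported in a finite set \<open>F\<close>, then the sum of \<open>(d\<^sub>k f)\<^sup>q\<close> over \<open>F\<close> is at most
  \<open>C\<^sup>q\<close> (lemma \<open>sum_coord_norm_le\<close>, from the extremal sequence in Hoelder's inequality).

  Suppose that \<open>A\<close> is a \<open>q\<close>-(V) set. Its coordinate images are \<open>q\<close>-(V) sets because the coordinate
  injections preserve weak summability. If the tails were not uniformly small, there would be
  disjoint finite blocks of indices, functionals \<open>f\<^sub>j\<close> in \<open>A\<close> and vectors \<open>x\<^sub>j\<close> of norm at most one supported in
  the \<open>j\<close>-th block at which \<open>f\<^sub>j\<close> stays away from zero. Such vectors are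
  weakly \<open>q\<close>-summable: \<open>\<bar>g x\<^sub>j\<bar>\<^sup>q\<close> is at most the part of the sum of \<open>(d\<^sub>k g)\<^sup>q\<close> over the \<open>j\<close>-th
  block, and these parts add up to at most the \<open>q\<close>-th power of the norm of \<open>g\<close>. This contradicts
  the (V) property.

  Suppose now that the coordinate images are \<open>q\<close>-(V) sets and that the tails are uniformly small,
  and let \<open>(x\<^sub>j)\<close> be weakly \<open>q\<close>-summable. Split \<open>f x\<^sub>j\<close> at an index \<open>n\<close>. The finitely many
  coordinates below \<open>n\<close> contribute terms that tend to zero uniformly on \<open>A\<close>. The rest is the value
  at \<open>x\<^sub>j\<close> of the tail functional of \<open>f\<close>, whose norm is small uniformly on \<open>A\<close>. The evaluations at
  the \<open>x\<^sub>j\<close> are pointwise bounded on the dual space of \<open>Y\<close>, which is complete since the scalars are,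
  so the uniform boundedness principle (lemma \<open>weakly_bounded_imp_uniform\<close>) bounds
  \<open>\<bar>g x\<^sub>j\<bar>\<close> by a fixed multiple of the norm of \<open>g\<close>, and the tail contributes little as well.

  The \<open>p\<close>-sum and the null sequence sum are treated together: each is the direct sum along a solid
  space of scalar sequences, and the locale \<open>sequence_gauge\<close> lists the properties of
  that scalar space on which the argument relies.
\<close>

section \<open>Scalar sequence spaces and their dual exponent\<close>

text \<open>
  Both factors are normalised to have norm one, and Young's inequality is applied to each term.
\<close>

lemma Hoelder_sum:
  fixes a b :: "'i \<Rightarrow> real"
  assumes pq: "1 < p" "1 < q" "1 / p + 1 / q = 1"
    and nonneg: "\<And>k. 0 \<le> a k" "\<And>k. 0 \<le> b k"
  shows "(\<Sum>k\<in>F. a k * b k) \<le> (\<Sum>k\<in>F. a k powr q) powr (1 / q) * (\<Sum>k\<in>F. b k powr p) powr (1 / p)"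
proof (cases "finite F")
  case True
  define A where "A = (\<Sum>k\<in>F. a k powr q)"
  define B where "B = (\<Sum>k\<in>F. b k powr p)"
  have "A \<ge> 0" "B \<ge> 0" by (auto simp: A_def B_def intro: sum_nonneg)
  show ?thesis
  proof (cases "A = 0 \<or> B = 0")
    case True
    then have "\<forall>k\<in>F. a k * b k = 0"
      using \<open>finite F\<close> nonneg by (auto simp: A_def B_def sum_nonneg_eq_0_iff)
    then have "(\<Sum>k\<in>F. a k * b k) = 0" by (rule sum.neutral)
    then show ?thesis by simp
  next
    case False
    then have pos: "A > 0" "B > 0" using \<open>A \<ge> 0\<close> \<open>B \<ge> 0\<close> by auto
    define \<alpha> where "\<alpha> = A powr (1 / q)"
    define \<beta> where "\<beta> = B powr (1 / p)"
    have ab: "\<alpha> > 0" "\<beta> > 0" "\<alpha> powr q = A" "\<beta> powr p = B"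
      using pos pq by (auto simp: \<alpha>_def \<beta>_def powr_powr)
    have "(a k / \<alpha>) * (b k / \<beta>) \<le> a k powr q / (A * q) + b k powr p / (B * p)" for k
      using Youngs_inequality[of q p "a k / \<alpha>" "b k / \<beta>"] pq nonneg ab
      by (simp add: powr_divide add.commute)
    then have "(\<Sum>k\<in>F. (a k / \<alpha>) * (b k / \<beta>)) \<le> (\<Sum>k\<in>F. a k powr q / (A * q) + b k powr p / (B * p))"
      by (intro sum_mono)
    also have "\<dots> = A / (A * q) + B / (B * p)"
      by (simp add: sum.distrib A_def B_def sum_divide_distrib)
    also have "\<dots> = 1" using pos pq by simp
    finally have "(\<Sum>k\<in>F. a k * b k) / (\<alpha> * \<beta>) \<le> 1"
      by (simp add: sum_divide_distrib)
    then show ?thesis using ab by (simp add: \<alpha>_def \<beta>_def A_def B_def divide_le_eq)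
  qed
qed simp

text \<open>
  \<open>L\<close> singles out a solid space of nonnegative scalar sequences with size functional \<open>N\<close>. The last two
  axioms say that the norm on finite sections dual to \<open>N\<close> is the \<open>q\<close>-norm: \<open>Hoelder\<close> is the
  upper bound, and \<open>extremal\<close> gives equality for some sequence in the unit ball. By \<open>N_tail\<close>,
  finitely supported sequences are dense.
\<close>

locale sequence_gauge =
  fixes L :: "(nat \<Rightarrow> real) \<Rightarrow> bool" and N :: "(nat \<Rightarrow> real) \<Rightarrow> real" and q :: real
  assumes q_pos: "0 < q"
    and solid: "\<lbrakk>\<And>k. 0 \<le> s k; \<And>k. s k \<le> t k; L t\<rbrakk> \<Longrightarrow> L s \<and> N s \<le> N t"
    and L_add: "\<lbrakk>\<And>k. 0 \<le> s k; \<And>k. 0 \<le> t k; L s; L t\<rbrakk> \<Longrightarrow> L (\<lambda>k. s k + t k)"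
    and scale: "\<lbrakk>0 \<le> c; \<And>k. 0 \<le> s k; L s\<rbrakk> \<Longrightarrow> L (\<lambda>k. c * s k) \<and> N (\<lambda>k. c * s k) = c * N s"
    and L_finite: "\<lbrakk>finite F; \<And>k. k \<notin> F \<Longrightarrow> s k = 0\<rbrakk> \<Longrightarrow> L s"
    and N_single: "0 \<le> a \<Longrightarrow> N (\<lambda>k. if k = n then a else 0) \<le> a"
    and N_tail: "\<lbrakk>\<And>k. 0 \<le> s k; L s\<rbrakk> \<Longrightarrow> (\<lambda>n. N (\<lambda>k. if k < n then 0 else s k)) \<longlonglongrightarrow> 0"
    and Hoelder: "\<lbrakk>finite F; \<And>k. 0 \<le> t k; \<And>k. 0 \<le> s k; L s\<rbrakk> \<Longrightarrow>
      (\<Sum>k\<in>F. t k * s k) \<le> (\<Sum>k\<in>F. t k powr q) powr (1 / q) * N s"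
    and extremal: "\<lbrakk>finite F; \<And>k. 0 \<le> t k\<rbrakk> \<Longrightarrow> \<exists>s. (\<forall>k. 0 \<le> s k) \<and> (\<forall>k. k \<notin> F \<longrightarrow> s k = 0) \<and>
      N s \<le> 1 \<and> (\<Sum>k\<in>F. t k powr q) powr (1 / q) = (\<Sum>k\<in>F. t k * s k)"

text \<open>
  The extremal sequence for \<open>t\<close> is the one that makes Hoelder's inequality an equality, namely
  \<open>t\<^sub>k\<close> to the power \<open>q - 1\<close>, normalised in the \<open>p\<close>-norm.
\<close>

lemma sequence_gauge_lp:
  assumes p: "1 < p" and pq: "1 / p + 1 / q = 1"
  shows "sequence_gauge (\<lambda>s. summable (\<lambda>n. s n powr p)) (\<lambda>s. (\<Sum>n. s n powr p) powr (1 / p)) q"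
proof
  have q: "1 < q"
    using p pq by (smt (verit) divide_less_eq_1_pos divide_nonneg_nonpos divide_pos_pos le_divide_eq_1_pos)
  then show "0 < q" by simp
  show "summable (\<lambda>n. s n powr p) \<and> (\<Sum>n. s n powr p) powr (1 / p) \<le> (\<Sum>n. t n powr p) powr (1 / p)"
    if "\<And>k. 0 \<le> s k" "\<And>k. s k \<le> t k" "summable (\<lambda>n. t n powr p)" for s t :: "nat \<Rightarrow> real"
  proof -
    have le: "s n powr p \<le> t n powr p" for n using that p by (intro powr_mono2) auto
    have "summable (\<lambda>n. s n powr p)"
      using le by (intro summable_comparison_test'[OF that(3), of 0]) auto
    then show ?thesis using le that p by (auto intro!: powr_mono2 suminf_le suminf_nonneg)
  qed
  show "summable (\<lambda>n. (s n + t n) powr p)"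
    if "\<And>k. 0 \<le> s k" "\<And>k. 0 \<le> t k" "summable (\<lambda>n. s n powr p)" "summable (\<lambda>n. t n powr p)"
    for s t :: "nat \<Rightarrow> real"
  proof (rule summable_comparison_test'[of _ 0])
    show "summable (\<lambda>n. 2 powr p * (s n powr p + t n powr p))"
      using that by (intro summable_mult summable_add)
    show "norm ((s n + t n) powr p) \<le> 2 powr p * (s n powr p + t n powr p)" for n
    proof -
      have "(s n + t n) powr p \<le> (2 * max (s n) (t n)) powr p"
        using that p by (intro powr_mono2) auto
      also have "\<dots> = 2 powr p * max (s n) (t n) powr p"
        by (intro powr_mult)
      also have "\<dots> \<le> 2 powr p * (s n powr p + t n powr p)"
        by (intro mult_left_mono) (auto simp: max_def)
      finally show ?thesis by simp
    qed
  qed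
  show "summable (\<lambda>n. (c * s n) powr p) \<and>
      (\<Sum>n. (c * s n) powr p) powr (1 / p) = c * (\<Sum>n. s n powr p) powr (1 / p)"
    if "0 \<le> c" "\<And>k. 0 \<le> s k" "summable (\<lambda>n. s n powr p)" for c and s :: "nat \<Rightarrow> real"
  proof -
    have eq: "(\<lambda>n. (c * s n) powr p) = (\<lambda>n. c powr p * s n powr p)"
      using that by (auto simp: powr_mult)
    have "0 \<le> (\<Sum>n. s n powr p)" using that by (simp add: suminf_nonneg)
    then show ?thesis
      unfolding eq using that p
      by (simp add: suminf_mult summable_mult powr_mult powr_powr)
  qed
  show "summable (\<lambda>n. s n powr p)" if "finite F" "\<And>k. k \<notin> F \<Longrightarrow> s k = 0"
    for F and s :: "nat \<Rightarrow> real"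
    by (rule summable_finite[OF that(1)]) (use that(2) p in auto)
  show "(\<Sum>k. (if k = n then a else 0) powr p) powr (1 / p) \<le> a" if "0 \<le> a" for a and n :: nat
  proof -
    have "(\<Sum>k. (if k = n then a else 0) powr p) = a powr p"
      by (subst suminf_finite[of "{n}"]) (use p in auto)
    then show ?thesis using that p by (simp add: powr_powr)
  qed
  show "(\<lambda>n. (\<Sum>k. (if k < n then 0 else s k) powr p) powr (1 / p)) \<longlonglongrightarrow> 0"
    if "\<And>k. 0 \<le> s k" "summable (\<lambda>n. s n powr p)" for s :: "nat \<Rightarrow> real"
  proof -
    let ?f = "\<lambda>k. s k powr p"
    have *: "(\<Sum>k. (if k < n then 0 else s k) powr p) = suminf ?f - sum ?f {..<n}" for n
    proof -
      have "(\<lambda>k. ?f k - (if k \<in> {..<n} then ?f k else 0)) sums (suminf ?f - sum ?f {..<n})"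
        using that by (intro sums_diff sums_If_finite_set summable_sums) auto
      moreover have "(\<lambda>k. ?f k - (if k \<in> {..<n} then ?f k else 0)) = (\<lambda>k. (if k < n then 0 else s k) powr p)"
        by auto
      ultimately show ?thesis by (simp add: sums_iff)
    qed
    have "(\<lambda>n. suminf ?f - sum ?f {..<n}) \<longlonglongrightarrow> suminf ?f - suminf ?f"
      using that by (intro tendsto_diff tendsto_const summable_LIMSEQ)
    then have lim: "(\<lambda>n. \<Sum>k. (if k < n then 0 else s k) powr p) \<longlonglongrightarrow> 0" by (simp add: *)
    have "0 \<le> (\<Sum>k. (if k < n then 0 else s k) powr p)" for n
      unfolding * using that by (auto intro!: sum_le_suminf)
    then show ?thesis
      using tendsto_powr2[OF lim tendsto_const[of "1 / p"]] p by simp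
  qed
  show "(\<Sum>k\<in>F. t k * s k) \<le> (\<Sum>k\<in>F. t k powr q) powr (1 / q) * (\<Sum>n. s n powr p) powr (1 / p)"
    if "finite F" "\<And>k. 0 \<le> t k" "\<And>k. 0 \<le> s k" "summable (\<lambda>n. s n powr p)"
    for F and s t :: "nat \<Rightarrow> real"
  proof -
    have "(\<Sum>k\<in>F. t k * s k) \<le> (\<Sum>k\<in>F. t k powr q) powr (1 / q) * (\<Sum>k\<in>F. s k powr p) powr (1 / p)"
      using p q pq that by (intro Hoelder_sum) auto
    also have "\<dots> \<le> (\<Sum>k\<in>F. t k powr q) powr (1 / q) * (\<Sum>n. s n powr p) powr (1 / p)"
      using p that by (intro mult_left_mono powr_mono2 sum_le_suminf) (auto intro: sum_nonneg)
    finally show ?thesis .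
  qed
  show "\<exists>s. (\<forall>k. 0 \<le> s k) \<and> (\<forall>k. k \<notin> F \<longrightarrow> s k = 0) \<and> (\<Sum>n. s n powr p) powr (1 / p) \<le> 1 \<and>
      (\<Sum>k\<in>F. t k powr q) powr (1 / q) = (\<Sum>k\<in>F. t k * s k)"
    if "finite F" "\<And>k. 0 \<le> t k" for F and t :: "nat \<Rightarrow> real"
  proof -
    define S where "S = (\<Sum>k\<in>F. t k powr q)"
    \<comment> \<open>If \<open>S = 0\<close>, then division by zero makes \<open>s\<close> the zero sequence, which is extremal for \<open>t = 0\<close>.\<close>
    define s where "s k = (if k \<in> F then t k powr (q - 1) / S powr (1 / p) else 0)" for k
    have S: "0 \<le> S" by (auto simp: S_def intro: sum_nonneg)
    have exps: "(q - 1) * p = q" "1 - 1 / p = 1 / q"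
      using p q pq by (auto simp: field_simps)
    have "(\<Sum>n. s n powr p) = (\<Sum>k\<in>F. t k powr q / S)"
    proof -
      have "(\<Sum>n. s n powr p) = (\<Sum>k\<in>F. s k powr p)"
        using that p by (intro suminf_finite) (auto simp: s_def)
      also have "\<dots> = (\<Sum>k\<in>F. t k powr q / S)"
        using p S by (intro sum.cong) (auto simp: s_def powr_divide powr_powr exps)
      finally show ?thesis .
    qed
    also have "\<dots> = S / S" by (simp only: S_def sum_divide_distrib)
    finally have "(\<Sum>n. s n powr p) \<le> 1" by simp
    moreover have "0 \<le> (\<Sum>n. s n powr p)"
      unfolding \<open>(\<Sum>n. s n powr p) = (\<Sum>k\<in>F. t k powr q / S)\<close> using S by (auto intro: sum_nonneg)
    ultimately have "(\<Sum>n. s n powr p) powr (1 / p) \<le> 1"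
      using p powr_mono2[of "1 / p" "\<Sum>n. s n powr p" 1] by simp
    moreover have "S powr (1 / q) = (\<Sum>k\<in>F. t k * s k)"
    proof -
      have "t k * t k powr (q - 1) = t k powr q" for k
        using that(2)[of k] q by (cases "t k = 0") (auto simp: powr_mult_base)
      then have "(\<Sum>k\<in>F. t k * s k) = (\<Sum>k\<in>F. t k powr q / S powr (1 / p))"
        by (intro sum.cong) (auto simp: s_def)
      also have "\<dots> = S powr 1 / S powr (1 / p)" using S by (simp add: S_def sum_divide_distrib)
      also have "\<dots> = S powr (1 / q)" by (simp only: powr_diff[symmetric] exps)
      finally show ?thesis by simp
    qed
    ultimately show ?thesis
      by (intro exI[of _ s]) (auto simp: s_def S_def)
  qed
qed

text \<open>
  Here \<open>q = 1\<close>, and the indicator sequence of \<open>F\<close> is extremal for every \<open>t\<close>.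
\<close>

lemma sequence_gauge_c0:
  "sequence_gauge (\<lambda>s. s \<longlonglongrightarrow> 0) (\<lambda>s. SUP n. s n) 1"
proof
  have bdd: "bdd_above (range s)" if "s \<longlonglongrightarrow> 0" for s :: "nat \<Rightarrow> real"
    using that by (meson Bseq_bdd_above convergentI convergent_imp_Bseq)
  show "(0::real) < 1" by simp
  show "s \<longlonglongrightarrow> 0 \<and> (SUP n. s n) \<le> (SUP n. t n)"
    if "\<And>k. 0 \<le> s k" "\<And>k. s k \<le> t k" "t \<longlonglongrightarrow> 0" for s t :: "nat \<Rightarrow> real"
    using that bdd[of t] by (auto intro!: cSUP_mono intro: tendsto_sandwich[of "\<lambda>_. 0" s _ t])
  show "(\<lambda>k. s k + t k) \<longlonglongrightarrow> 0" if "s \<longlonglongrightarrow> 0" "t \<longlonglongrightarrow> 0" for s t :: "nat \<Rightarrow> real"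
    using tendsto_add[OF that] by simp
  show "(\<lambda>k. c * s k) \<longlonglongrightarrow> 0 \<and> (SUP n. c * s n) = c * (SUP n. s n)"
    if "0 \<le> c" "s \<longlonglongrightarrow> 0" for c and s :: "nat \<Rightarrow> real"
  proof
    show "(\<lambda>k. c * s k) \<longlonglongrightarrow> 0" using tendsto_mult_right_zero[OF that(2)] .
    show "(SUP n. c * s n) = c * (SUP n. s n)"
    proof (cases "c = 0")
      case False
      then have "0 < c" using that by simp
      show ?thesis
      proof (rule antisym)
        show "(SUP n. c * s n) \<le> c * (SUP n. s n)"
          using that bdd[OF that(2)] by (intro cSUP_least mult_left_mono cSUP_upper) auto
        have "(SUP n. s n) \<le> (SUP n. c * s n) / c"
          using \<open>0 < c\<close> bdd[OF \<open>(\<lambda>k. c * s k) \<longlonglongrightarrow> 0\<close>]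
          by (intro cSUP_least) (auto simp: field_simps intro: cSUP_upper)
        then show "c * (SUP n. s n) \<le> (SUP n. c * s n)"
          using \<open>0 < c\<close> by (simp add: field_simps)
      qed
    qed simp
  qed
  show L_fin: "s \<longlonglongrightarrow> 0" if "finite F" "\<And>k. k \<notin> F \<Longrightarrow> s k = 0" for F and s :: "nat \<Rightarrow> real"
  proof -
    have "finite {k. s k \<noteq> 0}" by (rule finite_subset[OF _ that(1)]) (use that(2) in auto)
    then have "eventually (\<lambda>k. s k = 0) sequentially"
      by (auto simp: cofinite_eq_sequentially[symmetric] eventually_cofinite)
    then show ?thesis by (rule tendsto_eventually)
  qed
  show "(SUP k. if k = n then a else 0) \<le> a" if "0 \<le> a" for a :: real and n :: nat
    using that by (intro cSUP_least) auto
  show "(\<lambda>n. SUP k. if k < n then 0 else s k) \<longlonglongrightarrow> 0"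
    if s: "\<And>k. 0 \<le> s k" "s \<longlonglongrightarrow> 0" for s :: "nat \<Rightarrow> real"
  proof (rule LIMSEQ_I)
    fix e :: real assume "0 < e"
    then have "0 < e / 2" by simp
    from LIMSEQ_D[OF s(2) this] obtain n0 where n0: "\<And>n. n \<ge> n0 \<Longrightarrow> norm (s n - 0) < e / 2" by blast
    have "norm ((SUP k. if k < n then 0 else s k) - 0) < e" if "n \<ge> n0" for n
    proof -
      have le: "(if k < n then 0 else s k) \<le> e / 2" for k
        using n0[of k] that \<open>0 < e\<close> by auto
      then have "(SUP k. if k < n then 0 else s k) \<le> e / 2" by (intro cSUP_least) auto
      moreover have "0 \<le> (SUP k. if k < n then 0 else s k)"
        using s(1)[of n] le by (intro cSUP_upper2[of _ _ n] bdd_aboveI2[where M = "e / 2"]) simp_all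
      ultimately show ?thesis using \<open>0 < e\<close> by simp
    qed
    then show "\<exists>n0. \<forall>n\<ge>n0. norm ((SUP k. if k < n then 0 else s k) - 0) < e" by blast
  qed
  show "(\<Sum>k\<in>F. t k * s k) \<le> (\<Sum>k\<in>F. t k powr 1) powr (1 / 1) * (SUP n. s n)"
    if "finite F" "\<And>k. 0 \<le> t k" "\<And>k. 0 \<le> s k" "s \<longlonglongrightarrow> 0" for F and s t :: "nat \<Rightarrow> real"
  proof -
    have "(\<Sum>k\<in>F. t k * s k) \<le> (\<Sum>k\<in>F. t k * (SUP n. s n))"
      using that bdd[of s] by (intro sum_mono mult_left_mono cSUP_upper) auto
    then show ?thesis using that by (simp add: sum_distrib_right sum_nonneg)
  qed
  show "\<exists>s. (\<forall>k. 0 \<le> s k) \<and> (\<forall>k. k \<notin> F \<longrightarrow> s k = 0) \<and> (SUP n. s n) \<le> 1 \<and>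
      (\<Sum>k\<in>F. t k powr 1) powr (1 / 1) = (\<Sum>k\<in>F. t k * s k)"
    if "finite F" "\<And>k. 0 \<le> t k" for F and t :: "nat \<Rightarrow> real"
  proof (intro exI conjI allI impI)
    let ?s = "\<lambda>k. if k \<in> F then 1 else 0 :: real"
    show "(SUP n. ?s n) \<le> 1" by (intro cSUP_least) auto
    show "(\<Sum>k\<in>F. t k powr 1) powr (1 / 1) = (\<Sum>k\<in>F. t k * ?s k)"
      using that by (simp add: sum_nonneg)
  qed auto
qed

section \<open>Functionals and uniform boundedness\<close>

text \<open>
  These are the properties of a normed module that enter the estimates for functionals: closure under
  the operations and absolute homogeneity of the norm. Both the summands and the direct sums satisfy
  them.
\<close>

locale gauged_module =
  fixes E :: "('k :: {real_normed_field, banach}, 'a) normed_module" (structure)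
  assumes zero_closed: "\<zero>\<^bsub>E\<^esub> \<in> carrier E"
    and add_closed: "\<lbrakk>x \<in> carrier E; y \<in> carrier E\<rbrakk> \<Longrightarrow> x \<oplus>\<^bsub>E\<^esub> y \<in> carrier E"
    and smult_closed: "x \<in> carrier E \<Longrightarrow> a \<odot>\<^bsub>E\<^esub> x \<in> carrier E"
    and gauge_nonneg: "x \<in> carrier E \<Longrightarrow> 0 \<le> vnorm E x"
    and gauge_zero: "vnorm E \<zero>\<^bsub>E\<^esub> = 0"
    and gauge_smult: "x \<in> carrier E \<Longrightarrow> vnorm E (a \<odot>\<^bsub>E\<^esub> x) = norm a * vnorm E x"
begin

lemma dual_spaceI:
  assumes "\<And>x y. \<lbrakk>x \<in> carrier E; y \<in> carrier E\<rbrakk> \<Longrightarrow> f (x \<oplus>\<^bsub>E\<^esub> y) = f x + f y"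
    and "\<And>a x. x \<in> carrier E \<Longrightarrow> f (a \<odot>\<^bsub>E\<^esub> x) = a * f x"
    and "\<And>x. x \<in> carrier E \<Longrightarrow> norm (f x) \<le> C * vnorm E x"
  shows "(\<lambda>x\<in>carrier E. f x) \<in> dual_space E"
  unfolding dual_space_def
  using assms add_closed smult_closed by (auto intro!: exI[of _ C])

lemma dual_add: "\<lbrakk>f \<in> dual_space E; x \<in> carrier E; y \<in> carrier E\<rbrakk> \<Longrightarrow> f (x \<oplus>\<^bsub>E\<^esub> y) = f x + f y"
  and dual_smult: "\<lbrakk>f \<in> dual_space E; x \<in> carrier E\<rbrakk> \<Longrightarrow> f (a \<odot>\<^bsub>E\<^esub> x) = a * f x"
  by (auto simp: dual_space_def)

lemma dual_bound:
  assumes "f \<in> dual_space E"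
  obtains C where "0 \<le> C" "\<And>x. x \<in> carrier E \<Longrightarrow> norm (f x) \<le> C * vnorm E x"
proof -
  obtain C where C: "\<And>x. x \<in> carrier E \<Longrightarrow> norm (f x) \<le> C * vnorm E x"
    using assms unfolding dual_space_def by blast
  have "norm (f x) \<le> max C 0 * vnorm E x" if "x \<in> carrier E" for x
    using C[OF that] gauge_nonneg[OF that] by (meson max.cobounded1 mult_right_mono order_trans)
  then show thesis by (intro that[of "max C 0"]) auto
qed

lemma dual_zero: "f \<in> dual_space E \<Longrightarrow> f \<zero>\<^bsub>E\<^esub> = 0"
  by (metis dual_bound gauge_zero mult_zero_right norm_le_zero_iff zero_closed)

lemma bdd_above_dual_norm:
  assumes "f \<in> dual_space E"
  shows "bdd_above ((\<lambda>x. norm (f x)) ` {x \<in> carrier E. vnorm E x \<le> 1})"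
proof -
  obtain C where "0 \<le> C" "\<And>x. x \<in> carrier E \<Longrightarrow> norm (f x) \<le> C * vnorm E x"
    using dual_bound[OF assms] by blast
  then show ?thesis
    by (intro bdd_aboveI2[where M = C]) (force intro: order_trans mult_left_le)
qed

lemma dual_norm_upper:
  "\<lbrakk>f \<in> dual_space E; x \<in> carrier E; vnorm E x \<le> 1\<rbrakk> \<Longrightarrow> norm (f x) \<le> dual_norm E f"
  unfolding dual_norm_def by (intro cSUP_upper bdd_above_dual_norm) auto

lemma dual_norm_nonneg:
  assumes "f \<in> dual_space E"
  shows "0 \<le> dual_norm E f"
  using dual_norm_upper[OF assms zero_closed] dual_zero[OF assms] gauge_zero by simp

lemma dual_norm_least:
  assumes "\<And>x. \<lbrakk>x \<in> carrier E; vnorm E x \<le> 1\<rbrakk> \<Longrightarrow> norm (f x) \<le> C"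
  shows "dual_norm E f \<le> C"
  unfolding dual_norm_def using assms zero_closed gauge_zero by (intro cSUP_least) auto

lemma dual_norm_bound:
  assumes "0 \<le> C" "\<And>x. x \<in> carrier E \<Longrightarrow> norm (f x) \<le> C * vnorm E x"
  shows "dual_norm E f \<le> C"
  by (rule dual_norm_least) (use assms in \<open>force intro: order_trans mult_left_le\<close>)

lemma norm_le_dual_norm:
  assumes f: "f \<in> dual_space E" and x: "x \<in> carrier E"
  shows "norm (f x) \<le> dual_norm E f * vnorm E x"
proof (cases "vnorm E x = 0")
  case True
  then show ?thesis using dual_bound[OF f] x by (metis mult_zero_right)
next
  case False
  then have pos: "0 < vnorm E x" using gauge_nonneg[OF x] by simp
  let ?y = "of_real (1 / vnorm E x) \<odot>\<^bsub>E\<^esub> x"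
  have "norm (f ?y) \<le> dual_norm E f"
    using pos x by (intro dual_norm_upper f) (simp_all add: smult_closed gauge_smult norm_divide)
  then show ?thesis using pos x f
    by (simp add: dual_smult norm_mult norm_divide field_simps)
qed

text \<open>
  Multiplying a nearly norming vector by a scalar of modulus one makes the value of \<open>f\<close> real and
  nonnegative, so that such values can be added up without cancellation. Working with a factor
  \<open>\<theta> < 1\<close> covers the functional of norm zero.
\<close>

lemma dual_norm_attained_upto:
  assumes f: "f \<in> dual_space E" and \<theta>: "0 < \<theta>" "\<theta> < 1"
  shows "\<exists>u\<in>carrier E. vnorm E u \<le> 1 \<and> f u = of_real (norm (f u)) \<and> \<theta> * dual_norm E f \<le> norm (f u)"
proof (cases "dual_norm E f = 0")
  case True
  then show ?thesis
    using zero_closed gauge_zero dual_zero[OF f] by (intro bexI[of _ "\<zero>\<^bsub>E\<^esub>"]) auto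
next
  case False
  then have pos: "0 < dual_norm E f" using dual_norm_nonneg[OF f] by simp
  then have "\<theta> * dual_norm E f < dual_norm E f" using \<theta> by simp
  then obtain u where u: "u \<in> carrier E" "vnorm E u \<le> 1" "\<theta> * dual_norm E f < norm (f u)"
    using dual_norm_least[of f "\<theta> * dual_norm E f"] by (meson not_le)
  then have fu: "f u \<noteq> 0" using pos \<theta> by (metis mult_pos_pos norm_zero order_less_imp_not_less)
  let ?a = "of_real (norm (f u)) / f u"
  have "norm ?a = 1" using fu by (simp add: norm_divide)
  moreover have "f (?a \<odot>\<^bsub>E\<^esub> u) = of_real (norm (f u))" using f u fu by (simp add: dual_smult)
  ultimately show ?thesis
    using u by (intro bexI[of _ "?a \<odot>\<^bsub>E\<^esub> u"]) (simp_all add: smult_closed gauge_smult)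
qed

text \<open>
  This is the completeness of the dual space in the form in which the gliding hump below needs it.
\<close>

lemma dual_space_limit:
  assumes h: "\<And>n. h n \<in> dual_space E"
    and lim: "\<And>x. x \<in> carrier E \<Longrightarrow> (\<lambda>n. h n x) \<longlonglongrightarrow> g x"
    and bd: "\<And>n x. x \<in> carrier E \<Longrightarrow> norm (h n x) \<le> C * vnorm E x"
  shows "(\<lambda>x\<in>carrier E. g x) \<in> dual_space E"
proof (rule dual_spaceI)
  show "g (x \<oplus>\<^bsub>E\<^esub> y) = g x + g y" if "x \<in> carrier E" "y \<in> carrier E" for x y
  proof (rule LIMSEQ_unique)
    show "(\<lambda>n. h n (x \<oplus>\<^bsub>E\<^esub> y)) \<longlonglongrightarrow> g (x \<oplus>\<^bsub>E\<^esub> y)" using that by (intro lim add_closed)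
    show "(\<lambda>n. h n (x \<oplus>\<^bsub>E\<^esub> y)) \<longlonglongrightarrow> g x + g y"
      using tendsto_add[OF lim lim] that by (simp add: dual_add[OF h])
  qed
  show "g (a \<odot>\<^bsub>E\<^esub> x) = a * g x" if "x \<in> carrier E" for a x
  proof (rule LIMSEQ_unique)
    show "(\<lambda>n. h n (a \<odot>\<^bsub>E\<^esub> x)) \<longlonglongrightarrow> g (a \<odot>\<^bsub>E\<^esub> x)" using that by (intro lim smult_closed)
    show "(\<lambda>n. h n (a \<odot>\<^bsub>E\<^esub> x)) \<longlonglongrightarrow> a * g x"
      using tendsto_mult_left[OF lim[OF that]] that by (simp add: dual_smult[OF h])
  qed
  show "norm (g x) \<le> C * vnorm E x" if "x \<in> carrier E" for x
    by (rule LIMSEQ_le_const2[OF tendsto_norm[OF lim[OF that]]]) (use bd that in auto)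
qed

lemma dual_space_add_scaled:
  assumes "f \<in> dual_space E" "g \<in> dual_space E"
  shows "(\<lambda>x\<in>carrier E. f x + c * g x) \<in> dual_space E"
proof -
  obtain C where C: "\<And>x. x \<in> carrier E \<Longrightarrow> norm (f x) \<le> C * vnorm E x"
    using dual_bound[OF assms(1)] by blast
  obtain D where D: "\<And>x. x \<in> carrier E \<Longrightarrow> norm (g x) \<le> D * vnorm E x"
    using dual_bound[OF assms(2)] by blast
  have "norm (f x + c * g x) \<le> (C + norm c * D) * vnorm E x" if "x \<in> carrier E" for x
  proof -
    have "norm (f x + c * g x) \<le> norm (f x) + norm c * norm (g x)"
      by (metis norm_mult norm_triangle_ineq)
    also have "\<dots> \<le> C * vnorm E x + norm c * (D * vnorm E x)"
      using C D that by (intro add_mono mult_left_mono) auto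
    finally show ?thesis by (simp add: algebra_simps)
  qed
  then show ?thesis
    using assms by (intro dual_spaceI[where C = "C + norm c * D"])
      (simp_all add: dual_add dual_smult algebra_simps)
qed

text \<open>
  The uniform boundedness principle for the evaluations at \<open>x\<^sub>j\<close> on the dual space, by a gliding
  hump. Let \<open>\<tau>\<^sub>j\<close> be the supremum of \<open>\<bar>f x\<^sub>j\<bar>\<close> over the dual unit ball. If these are unbounded, one
  chooses \<open>j\<^sub>n\<close> with \<open>\<tau>\<close> at \<open>j\<^sub>n\<close> of order \<open>3\<^sup>n * n\<close> and \<open>g\<^sub>n\<close> in the unit ball that attains at least
  three quarters of it, and forms a signed series of the functionals \<open>3\<^sup>-\<^sup>n * g\<^sub>n\<close>. The sign of each
  term is chosen such that adding it leaves a value of size at least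
  \<open>3\<^sup>-\<^sup>n * \<bar>g\<^sub>n (x at j\<^sub>n)\<bar>\<close> at the \<open>n\<close>-th vector; all later terms together can remove at most
  two thirds of it. The limit is therefore unbounded on the sequence.
\<close>

lemma weakly_bounded_imp_uniform:
  assumes x: "\<And>j :: nat. x j \<in> carrier E"
    and bounded: "\<And>f. f \<in> dual_space E \<Longrightarrow> \<exists>B. \<forall>j. norm (f (x j)) \<le> B"
  shows "\<exists>M\<ge>0. \<forall>f\<in>dual_space E. \<forall>j. norm (f (x j)) \<le> M * dual_norm E f"
proof (rule ccontr)
  assume neg: "\<not> ?thesis"
  define U where "U = {f \<in> dual_space E. dual_norm E f \<le> 1}"
  define z where "z = (\<lambda>y\<in>carrier E. 0 :: 'k)"
  have z: "z \<in> dual_space E" unfolding z_def by (rule dual_spaceI[where C = 0]) auto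
  have U_bound: "norm (f y) \<le> vnorm E y" if "f \<in> U" "y \<in> carrier E" for f y
    using norm_le_dual_norm[of f y] that gauge_nonneg[OF that(2)]
    by (auto simp: U_def intro: order_trans mult_left_le_one_le dual_norm_nonneg)
  have large: "\<exists>f\<in>U. \<exists>j. M < norm (f (x j))" if "0 \<le> M" for M
  proof -
    from neg that obtain f j where f: "f \<in> dual_space E" "M * dual_norm E f < norm (f (x j))"
      by (meson not_le)
    have "norm (f (x j)) \<le> dual_norm E f * vnorm E (x j)"
      by (intro norm_le_dual_norm f x)
    then have pos: "0 < dual_norm E f"
      using f dual_norm_nonneg[OF f(1)] that by (cases "dual_norm E f = 0") auto
    let ?c = "of_real (1 / dual_norm E f) :: 'k"
    let ?g = "\<lambda>y\<in>carrier E. z y + ?c * f y"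
    have g: "?g \<in> dual_space E" by (intro dual_space_add_scaled f z)
    have "norm (?g y) \<le> 1 * vnorm E y" if "y \<in> carrier E" for y
      using norm_le_dual_norm[OF f(1) that] pos that
      by (simp add: z_def norm_mult norm_divide field_simps)
    then have "?g \<in> U" using g unfolding U_def by (auto intro: dual_norm_bound)
    moreover have "M < norm (?g (x j))"
      using f(2) pos x by (simp add: z_def norm_mult norm_divide field_simps)
    ultimately show ?thesis by blast
  qed
  \<comment> \<open>The last conjunct says that \<open>g\<close> nearly attains the supremum over \<open>U\<close>, up to the factor \<open>4 / 3\<close>.\<close>
  have "\<exists>g j. g \<in> U \<and> 4 * 3 ^ n * real n < norm (g (x j)) \<and>
      (\<forall>f\<in>U. norm (f (x j)) \<le> 4 / 3 * norm (g (x j)))" for n :: nat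
  proof -
    obtain f j where f: "f \<in> U" "6 * 3 ^ n * real n < norm (f (x j))"
      using large[of "6 * 3 ^ n * real n"] by auto
    let ?\<tau> = "SUP f\<in>U. norm (f (x j))"
    have bdd: "bdd_above ((\<lambda>f. norm (f (x j))) ` U)"
      using U_bound x by (intro bdd_aboveI2[where M = "vnorm E (x j)"]) auto
    have "norm (f (x j)) \<le> ?\<tau>" using f bdd by (intro cSUP_upper)
    then have \<tau>: "6 * 3 ^ n * real n < ?\<tau>" using f by simp
    have "0 \<le> 6 * 3 ^ n * real n" by simp
    then have "0 < ?\<tau>" using \<tau> by linarith
    then have "3 / 4 * ?\<tau> < ?\<tau>" by simp
    then obtain g where g: "g \<in> U" "3 / 4 * ?\<tau> < norm (g (x j))"
      using bdd f(1) by (subst (asm) less_cSUP_iff) auto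
    have "norm (k (x j)) \<le> 4 / 3 * norm (g (x j))" if "k \<in> U" for k
      using cSUP_upper[OF that bdd] g(2) by simp
    moreover have "4 * 3 ^ n * real n = 2 / 3 * (6 * 3 ^ n * real n)" by simp
    then have "4 * 3 ^ n * real n < norm (g (x j))" using g(2) \<tau> \<open>0 \<le> 6 * 3 ^ n * real n\<close> by linarith
    ultimately show ?thesis using g(1) by blast
  qed
  then obtain g j where g: "\<And>n. g n \<in> U" "\<And>n. 4 * 3 ^ n * real n < norm (g n (x (j n)))"
    "\<And>n f. f \<in> U \<Longrightarrow> norm (f (x (j n))) \<le> 4 / 3 * norm (g n (x (j n)))"
    by metis
  \<comment> \<open>Since \<open>\<bar>a + b\<bar> + \<bar>a - b\<bar> \<ge> 2 * \<bar>b\<bar>\<close>, one of the two signs keeps the sum at least as large as \<open>b\<close>.\<close>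
  define c where "c f n = (if (1/3) ^ n * norm (g n (x (j n))) \<le> norm (f (x (j n)) + (1/3) ^ n * g n (x (j n)))
    then (1/3) ^ n else - ((1/3) ^ n) :: 'k)" for f :: "'a \<Rightarrow> 'k" and n
  have norm_c: "norm (c f n) = (1/3) ^ n" for f n
    by (simp add: c_def norm_power norm_divide)
  have c_large: "(1/3) ^ n * norm (g n (x (j n))) \<le> norm (f (x (j n)) + c f n * g n (x (j n)))" for f n
  proof -
    let ?a = "f (x (j n))" and ?b = "(1/3) ^ n * g n (x (j n))"
    have "norm (?b + ?b) \<le> norm (?a + ?b) + norm (?a - ?b)"
      using norm_triangle_ineq4[of "?a + ?b" "?a - ?b"] by simp
    moreover have "norm (?b + ?b) = 2 * norm ?b"
      by (metis mult_2 norm_mult norm_numeral)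
    moreover have nb: "norm ?b = (1/3) ^ n * norm (g n (x (j n)))"
      by (simp add: norm_mult norm_power norm_divide)
    ultimately have *: "norm ?b \<le> norm (?a + ?b) \<or> norm ?b \<le> norm (?a - ?b)" by linarith
    show ?thesis
    proof (cases "norm ?b \<le> norm (?a + ?b)")
      case True
      then show ?thesis by (simp add: c_def nb)
    next
      case False
      with * have "norm ?b \<le> norm (?a - ?b)" by simp
      with False show ?thesis by (simp add: c_def nb)
    qed
  qed
  define h where "h = rec_nat z (\<lambda>n f. \<lambda>y\<in>carrier E. f y + c f n * g n y)"
  have h_rec: "h (Suc n) = (\<lambda>y\<in>carrier E. h n y + c (h n) n * g n y)" for n
    by (simp add: h_def)
  then have h_Suc: "h (Suc n) y = h n y + c (h n) n * g n y" if "y \<in> carrier E" for n y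
    using that by simp
  have h: "h n \<in> dual_space E" for n
  proof (induction n)
    case (Suc n)
    have "g n \<in> dual_space E" using g(1) by (simp add: U_def)
    with Suc show ?case unfolding h_rec by (intro dual_space_add_scaled)
  qed (simp add: h_def z)
  have diff: "norm (h (n + k) y - h n y) \<le> 3 / 2 * (1/3) ^ n * B"
    if y: "y \<in> carrier E" and B: "\<And>f. f \<in> U \<Longrightarrow> norm (f y) \<le> B" for n k y B
  proof -
    have "0 \<le> B" using B[OF g(1)[of 0]] norm_ge_zero order_trans by blast
    \<comment> \<open>the finite geometric sum of the steps from \<open>n\<close> to \<open>n + k\<close>\<close>
    have "norm (h (n + k) y - h n y) \<le> 3 / 2 * (1/3) ^ n * (1 - (1/3) ^ k) * B"
    proof (induction k)
      case (Suc k)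
      have "norm (h (n + Suc k) y - h n y) \<le> norm (h (n + k) y - h n y) + norm (c (h (n + k)) (n + k) * g (n + k) y)"
        using h_Suc[OF y, of "n + k"]
          norm_triangle_ineq[of "h (n + k) y - h n y" "c (h (n + k)) (n + k) * g (n + k) y"]
        by (simp add: algebra_simps)
      also have "\<dots> \<le> 3 / 2 * (1/3) ^ n * (1 - (1/3) ^ k) * B + (1/3) ^ (n + k) * B"
        unfolding norm_mult norm_c using Suc B[OF g(1)] by (intro add_mono mult_left_mono) auto
      also have "\<dots> = 3 / 2 * (1/3) ^ n * (1 - (1/3) ^ Suc k) * B"
        by (simp add: power_add field_simps)
      finally show ?case .
    qed simp
    also have "\<dots> \<le> 3 / 2 * (1/3) ^ n * 1 * B"
      using \<open>0 \<le> B\<close> by (intro mult_right_mono mult_left_mono) auto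
    finally show ?thesis by simp
  qed
  have h_bound: "norm (h n y) \<le> 3 / 2 * vnorm E y" if y: "y \<in> carrier E" for n y
  proof -
    have "norm (h (0 + n) y - h 0 y) \<le> 3 / 2 * (1/3) ^ 0 * vnorm E y"
      by (rule diff[OF y]) (rule U_bound[OF _ y])
    then show ?thesis using y by (simp add: h_def z_def)
  qed
  have conv: "convergent (\<lambda>n. h n y)" if y: "y \<in> carrier E" for y
  proof -
    have "h n y = (\<Sum>i<n. c (h i) i * g i y)" for n
      using y by (induction n) (auto simp: h_Suc h_def z_def)
    moreover have "summable (\<lambda>i. c (h i) i * g i y)"
    proof (rule summable_comparison_test'[of _ 0])
      show "summable (\<lambda>i. (1/3 :: real) ^ i * vnorm E y)"
        by (intro summable_mult2 summable_geometric) simp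
      show "norm (c (h i) i * g i y) \<le> (1/3) ^ i * vnorm E y" for i
        unfolding norm_mult norm_c using U_bound[OF g(1) y] by (intro mult_left_mono) auto
    qed
    ultimately show ?thesis by (simp add: summable_iff_convergent)
  qed
  define l where "l y = lim (\<lambda>n. h n y)" for y
  have lim: "(\<lambda>n. h n y) \<longlonglongrightarrow> l y" if "y \<in> carrier E" for y
    unfolding l_def using conv[OF that] by (simp add: convergent_LIMSEQ_iff)
  have "(\<lambda>y\<in>carrier E. l y) \<in> dual_space E"
    by (rule dual_space_limit[OF h lim h_bound])
  from bounded[OF this] obtain B where B: "\<And>j. norm (l (x j)) \<le> B" using x by auto
  obtain n where n: "B < real n" using reals_Archimedean2 by blast
  let ?y = "x (j n)" and ?G = "norm (g n (x (j n)))"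
  \<comment> \<open>what the terms after the \<open>n\<close>-th can change at the \<open>n\<close>-th vector\<close>
  have "norm (l ?y - h (Suc n) ?y) \<le> 3 / 2 * (1/3) ^ Suc n * (4 / 3 * ?G)"
  proof (rule LIMSEQ_le_const2)
    show "(\<lambda>k. norm (h (Suc n + k) ?y - h (Suc n) ?y)) \<longlonglongrightarrow> norm (l ?y - h (Suc n) ?y)"
      using LIMSEQ_ignore_initial_segment[OF lim[OF x[of "j n"]], of "Suc n"]
      by (intro tendsto_norm tendsto_diff tendsto_const) (simp add: add.commute)
    show "\<exists>N. \<forall>k\<ge>N. norm (h (Suc n + k) ?y - h (Suc n) ?y) \<le> 3 / 2 * (1/3) ^ Suc n * (4 / 3 * ?G)"
      by (intro exI allI impI diff[OF x]) (rule g(3))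
  qed
  moreover have "(1/3) ^ n * ?G \<le> norm (h (Suc n) ?y)"
    using c_large[of n "h n"] h_Suc[OF x] by simp
  moreover have "norm (h (Suc n) ?y) \<le> norm (l ?y) + norm (l ?y - h (Suc n) ?y)"
    by (metis norm_minus_commute norm_triangle_sub)
  moreover have "3 / 2 * (1/3) ^ Suc n * (4 / 3 * ?G) = 2 / 3 * ((1/3) ^ n * ?G)" by simp
  ultimately have "(1/3) ^ n * ?G \<le> 3 * norm (l ?y)" by linarith
  moreover have "(1/3) ^ n * (4 * 3 ^ n * real n) \<le> (1/3) ^ n * ?G"
    using g(2)[of n] by (intro mult_left_mono) auto
  moreover have "(1/3) ^ n * (4 * 3 ^ n * real n) = 4 * real n" by (simp add: power_divide)
  ultimately show False using B[of "j n"] n by linarith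
qed

end

lemma (in normed_space_on) gauged: "gauged_module E"
proof
  show "a \<odot>\<^bsub>E\<^esub> x \<in> carrier E" if "x \<in> carrier E" for a x
    using that by (simp add: ring_of_type_algebra_def)
qed (use vnorm_nonneg vnorm_smult in \<open>auto simp: vnorm_eq_zero\<close>)

lemma (in normed_space_on) smult_zero: "a \<odot>\<^bsub>E\<^esub> \<zero>\<^bsub>E\<^esub> = \<zero>\<^bsub>E\<^esub>"
  using smult_r_null[of a] by (simp add: ring_of_type_algebra_def)

section \<open>Uniform limits in the extended nonnegative reals\<close>

lemma tendsto_SUP_ennreal_zero_iff:
  fixes G :: "'i \<Rightarrow> nat \<Rightarrow> ennreal"
  shows "(\<lambda>n. SUP i\<in>A. G i n) \<longlonglongrightarrow> 0 \<longleftrightarrow>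
    (\<forall>\<epsilon>>0. \<exists>n0. \<forall>n\<ge>n0. \<forall>i\<in>A. G i n \<le> ennreal \<epsilon>)" (is "?L = ?R")
proof
  assume lim: ?L
  show ?R
  proof (intro allI impI)
    fix \<epsilon> :: real assume "0 < \<epsilon>"
    then have "0 < ennreal \<epsilon>" by simp
    from order_tendstoD(2)[OF lim this] obtain n0 where
      "\<And>n. n \<ge> n0 \<Longrightarrow> (SUP i\<in>A. G i n) < ennreal \<epsilon>"
      by (auto simp: eventually_sequentially)
    then show "\<exists>n0. \<forall>n\<ge>n0. \<forall>i\<in>A. G i n \<le> ennreal \<epsilon>"
      by (meson SUP_upper less_imp_le order_trans)
  qed
next
  assume R: ?R
  show ?L
  proof (rule order_tendstoI)
    fix a :: ennreal assume "0 < a"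
    then obtain b where b: "0 < b" "b < a" using dense by blast
    then obtain \<epsilon> where \<epsilon>: "b = ennreal \<epsilon>" "0 < \<epsilon>" by (cases b) auto
    with R obtain n0 where n0: "\<And>n i. \<lbrakk>n \<ge> n0; i \<in> A\<rbrakk> \<Longrightarrow> G i n \<le> ennreal \<epsilon>" by blast
    have "(SUP i\<in>A. G i n) < a" if "n \<ge> n0" for n
      using SUP_least[of A "\<lambda>i. G i n", OF n0[OF that]] b \<epsilon> by simp
    then show "\<forall>\<^sub>F n in sequentially. (SUP i\<in>A. G i n) < a"
      by (auto simp: eventually_sequentially)
  qed simp
qed

lemma V_set_iff:
  "V_set r E K \<longleftrightarrow> dual_bounded E K \<and> (\<forall>x. weakly_summable r E x \<longrightarrow>
    (\<forall>\<epsilon>>0. \<exists>j0. \<forall>j\<ge>j0. \<forall>f\<in>K. norm (f (x j)) \<le> \<epsilon>))"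
  unfolding V_set_def tendsto_SUP_ennreal_zero_iff by (simp add: ennreal_le_iff)

text \<open>
  Tail sums are handled through arbitrary finite sets of indices beyond \<open>n\<close>, so that restricting a
  sum to a block is just taking a subset.
\<close>

lemma suminf_ennreal_le_iff:
  fixes g :: "nat \<Rightarrow> real"
  assumes "\<And>k. 0 \<le> g k" "0 \<le> \<epsilon>"
  shows "(\<Sum>k. ennreal (g (n + k))) \<le> ennreal \<epsilon> \<longleftrightarrow>
    (\<forall>F. finite F \<and> F \<subseteq> {n..} \<longrightarrow> sum g F \<le> \<epsilon>)" (is "?L = ?R")
proof
  assume L: ?L
  show ?R
  proof (intro allI impI)
    fix F assume F: "finite F \<and> F \<subseteq> {n..}"
    define F' where "F' = (\<lambda>k. k - n) ` F"
    have "inj_on (\<lambda>k. k - n) F" using F by (intro inj_on_diff_nat) auto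
    then have "(\<Sum>k\<in>F'. g (n + k)) = sum g F"
      unfolding F'_def by (subst sum.reindex) (use F in \<open>auto intro!: sum.cong\<close>)
    then have "ennreal (sum g F) = (\<Sum>k\<in>F'. ennreal (g (n + k)))"
      using assms by (simp add: sum_ennreal)
    also have "\<dots> \<le> (\<Sum>k. ennreal (g (n + k)))"
      using F by (intro sum_le_suminf) (auto simp: F'_def)
    finally have "ennreal (sum g F) \<le> ennreal \<epsilon>" using L by simp
    then show "sum g F \<le> \<epsilon>" using assms by simp
  qed
next
  assume R: ?R
  show ?L
  proof (rule suminf_le_const)
    fix m
    have "(\<Sum>k<m. g (n + k)) = sum g {n..<n + m}"
      using sum.shift_bounds_nat_ivl[of g 0 n m] by (simp add: atLeast0LessThan add.commute)
    also have "\<dots> \<le> \<epsilon>" using R by (metis atLeastLessThan_iff atLeast_iff finite_atLeastLessThan subsetI)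
    finally show "(\<Sum>k<m. ennreal (g (n + k))) \<le> ennreal \<epsilon>"
      using assms by (simp add: sum_ennreal)
  qed simp
qed

section \<open>Duality for direct sums\<close>

text \<open>
  The direct sum along a scalar sequence space: the sequence of the norms of the coordinates is required
  to belong to \<open>L\<close>, and \<open>N\<close> measures it.
\<close>

definition gauge_sum :: "((nat \<Rightarrow> real) \<Rightarrow> bool) \<Rightarrow> ((nat \<Rightarrow> real) \<Rightarrow> real) \<Rightarrow>
    (nat \<Rightarrow> ('k, 'a) normed_module) \<Rightarrow> ('k, nat \<Rightarrow> 'a) normed_module" where
  "gauge_sum L N X = pointwise_space X
     {x. (\<forall>n. x n \<in> carrier (X n)) \<and> L (\<lambda>n. vnorm (X n) (x n))}
     (\<lambda>x. N (\<lambda>n. vnorm (X n) (x n)))"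

definition cutoff :: "(nat \<Rightarrow> ('k, 'a) normed_module) \<Rightarrow> nat set \<Rightarrow> (nat \<Rightarrow> 'a) \<Rightarrow> nat \<Rightarrow> 'a" where
  "cutoff X S x = (\<lambda>k. if k \<in> S then x k else \<zero>\<^bsub>X k\<^esub>)"

locale gauge_sum_of_normed_spaces = sequence_gauge L N q
  for L N q +
  fixes X :: "nat \<Rightarrow> ('k :: {real_normed_field, banach}, 'a) normed_module"
  assumes normed: "\<And>n. normed_space_on (X n)"
begin

abbreviation Y where "Y \<equiv> gauge_sum L N X"

abbreviation coord_norm :: "nat \<Rightarrow> ((nat \<Rightarrow> 'a) \<Rightarrow> 'k) \<Rightarrow> real" where
  "coord_norm n f \<equiv> dual_norm (X n) (coord_proj X n f)"

sublocale Xn: normed_space_on "X n" for n by (rule normed)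

sublocale Xn: gauged_module "X n" for n by (rule Xn.gauged)

lemma carrier_iff: "x \<in> carrier Y \<longleftrightarrow> (\<forall>n. x n \<in> carrier (X n)) \<and> L (\<lambda>n. vnorm (X n) (x n))"
  and vnorm_eq: "vnorm Y x = N (\<lambda>n. vnorm (X n) (x n))"
  and zero_eq: "\<zero>\<^bsub>Y\<^esub> = (\<lambda>n. \<zero>\<^bsub>X n\<^esub>)"
  and add_eq: "x \<oplus>\<^bsub>Y\<^esub> y = (\<lambda>n. x n \<oplus>\<^bsub>X n\<^esub> y n)"
  and smult_eq: "a \<odot>\<^bsub>Y\<^esub> x = (\<lambda>n. a \<odot>\<^bsub>X n\<^esub> x n)"
  by (simp_all add: gauge_sum_def pointwise_space_def)

lemma carrier_if_dominated:
  assumes "\<And>n. x n \<in> carrier (X n)" "\<And>n. vnorm (X n) (x n) \<le> s n" "L s"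
  shows "x \<in> carrier Y" "vnorm Y x \<le> N s"
  using solid[of "\<lambda>n. vnorm (X n) (x n)" s] assms
  by (auto simp: carrier_iff vnorm_eq Xn.gauge_nonneg)

sublocale Y: gauged_module Y
proof
  show "\<zero>\<^bsub>Y\<^esub> \<in> carrier Y"
    using L_finite[of "{}"] by (simp add: carrier_iff zero_eq Xn.gauge_zero)
  show "x \<oplus>\<^bsub>Y\<^esub> y \<in> carrier Y" if "x \<in> carrier Y" "y \<in> carrier Y" for x y
    unfolding add_eq
    by (rule carrier_if_dominated[where s = "\<lambda>n. vnorm (X n) (x n) + vnorm (X n) (y n)"])
      (use that in \<open>auto simp: carrier_iff Xn.vnorm_triangle Xn.gauge_nonneg intro: L_add\<close>)
  show "a \<odot>\<^bsub>Y\<^esub> x \<in> carrier Y" "vnorm Y (a \<odot>\<^bsub>Y\<^esub> x) = norm a * vnorm Y x"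
    if "x \<in> carrier Y" for a x
    using that scale[of "norm a" "\<lambda>n. vnorm (X n) (x n)"]
    by (auto simp: carrier_iff vnorm_eq smult_eq Xn.smult_closed Xn.gauge_smult Xn.gauge_nonneg)
  show zero: "vnorm Y \<zero>\<^bsub>Y\<^esub> = 0"
    using scale[of 0 "\<lambda>_. 0"] L_finite[of "{}" "\<lambda>_. 0"] by (simp add: vnorm_eq zero_eq Xn.gauge_zero)
  show "0 \<le> vnorm Y x" if "x \<in> carrier Y" for x
    using solid[of "\<lambda>_. 0" "\<lambda>n. vnorm (X n) (x n)"] that zero
    by (simp add: carrier_iff vnorm_eq zero_eq Xn.gauge_zero Xn.gauge_nonneg)
qed

lemma cutoff_mono:
  assumes "x \<in> carrier Y" "S \<subseteq> T"
  shows "cutoff X S x \<in> carrier Y" "vnorm Y (cutoff X S x) \<le> vnorm Y (cutoff X T x)"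
proof -
  have *: "cutoff X R x \<in> carrier Y" for R
    by (rule carrier_if_dominated[where s = "\<lambda>n. vnorm (X n) (x n)"])
      (use assms in \<open>auto simp: carrier_iff cutoff_def Xn.gauge_zero Xn.gauge_nonneg\<close>)
  show "cutoff X S x \<in> carrier Y" by (rule *)
  have "vnorm Y (cutoff X S x) \<le> N (\<lambda>n. vnorm (X n) (cutoff X T x n))"
    by (rule carrier_if_dominated)
      (use assms *[of S] *[of T] in \<open>auto simp: carrier_iff cutoff_def Xn.gauge_zero Xn.gauge_nonneg\<close>)
  then show "vnorm Y (cutoff X S x) \<le> vnorm Y (cutoff X T x)" by (simp add: vnorm_eq)
qed

lemma cutoff_UNIV: "cutoff X UNIV x = x" by (simp add: cutoff_def)

lemma cutoff_closed:
  assumes "x \<in> carrier Y"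
  shows "cutoff X S x \<in> carrier Y" "vnorm Y (cutoff X S x) \<le> vnorm Y x"
  using cutoff_mono[OF assms, of S UNIV] by (simp_all add: cutoff_UNIV)

lemma cutoff_finite_closed:
  assumes "finite F" "\<And>k. x k \<in> carrier (X k)"
  shows "cutoff X F x \<in> carrier Y"
  using assms L_finite[OF assms(1), of "\<lambda>n. vnorm (X n) (cutoff X F x n)"]
  by (simp add: carrier_iff cutoff_def Xn.gauge_zero)

lemma cutoff_Un:
  assumes "\<And>k. x k \<in> carrier (X k)" "S \<inter> T = {}"
  shows "cutoff X (S \<union> T) x = cutoff X S x \<oplus>\<^bsub>Y\<^esub> cutoff X T x"
  using assms by (auto simp: cutoff_def add_eq fun_eq_iff)

lemma coord_inj_closed:
  assumes "u \<in> carrier (X n)"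
  shows "coord_inj X n u \<in> carrier Y" "vnorm Y (coord_inj X n u) \<le> vnorm (X n) u"
proof -
  have eq: "(\<lambda>k. vnorm (X k) (coord_inj X n u k)) = (\<lambda>k. if k = n then vnorm (X n) u else 0)"
    by (auto simp: coord_inj_def Xn.gauge_zero)
  show "coord_inj X n u \<in> carrier Y"
    using assms L_finite[of "{n}" "\<lambda>k. if k = n then vnorm (X n) u else 0"]
    by (auto simp: carrier_iff eq) (simp add: coord_inj_def)
  show "vnorm Y (coord_inj X n u) \<le> vnorm (X n) u"
    unfolding vnorm_eq eq by (rule N_single[OF Xn.gauge_nonneg[OF assms]])
qed

lemma coord_proj_apply: "u \<in> carrier (X n) \<Longrightarrow> coord_proj X n f u = f (coord_inj X n u)"
  by (simp add: coord_proj_def adjoint_on_def)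

lemma coord_proj_in_dual:
  assumes f: "f \<in> dual_space Y"
  shows "coord_proj X n f \<in> dual_space (X n)"
  unfolding coord_proj_def adjoint_on_def
proof (rule Xn.dual_spaceI)
  have "coord_inj X n (u \<oplus>\<^bsub>X n\<^esub> v) = coord_inj X n u \<oplus>\<^bsub>Y\<^esub> coord_inj X n v" for u v
    by (auto simp: coord_inj_def add_eq)
  then show "f (coord_inj X n (u \<oplus>\<^bsub>X n\<^esub> v)) = f (coord_inj X n u) + f (coord_inj X n v)"
    if "u \<in> carrier (X n)" "v \<in> carrier (X n)" for u v
    using that by (simp add: Y.dual_add[OF f] coord_inj_closed)
  have "coord_inj X n (a \<odot>\<^bsub>X n\<^esub> u) = a \<odot>\<^bsub>Y\<^esub> coord_inj X n u" for a u
    by (auto simp: coord_inj_def smult_eq Xn.smult_zero)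
  then show "f (coord_inj X n (a \<odot>\<^bsub>X n\<^esub> u)) = a * f (coord_inj X n u)"
    if "u \<in> carrier (X n)" for a u
    using that by (simp add: Y.dual_smult[OF f] coord_inj_closed)
  show "norm (f (coord_inj X n u)) \<le> dual_norm Y f * vnorm (X n) u"
    if u: "u \<in> carrier (X n)" for u
    using Y.norm_le_dual_norm[OF f coord_inj_closed(1)[OF u]] coord_inj_closed(2)[OF u]
      Y.dual_norm_nonneg[OF f] by (meson mult_left_mono order_trans)
qed

lemma coord_norm_nonneg: "f \<in> dual_space Y \<Longrightarrow> 0 \<le> coord_norm n f"
  by (intro Xn.dual_norm_nonneg coord_proj_in_dual)

lemma coord_norm_le: "f \<in> dual_space Y \<Longrightarrow> coord_norm n f \<le> dual_norm Y f"
  by (rule Xn.dual_norm_least)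
    (auto simp: coord_proj_apply intro!: Y.dual_norm_upper coord_inj_closed
      intro: order_trans[OF coord_inj_closed(2)])

text \<open>
  Hoelder's inequality for the unit weight at a single index.
\<close>

lemma coord_contraction:
  assumes "x \<in> carrier Y"
  shows "vnorm (X n) (x n) \<le> vnorm Y x"
  using Hoelder[of "{n}" "\<lambda>_. 1" "\<lambda>n. vnorm (X n) (x n)"] assms
  by (simp add: carrier_iff vnorm_eq Xn.gauge_nonneg)

lemma coord_functional_in_dual:
  assumes g: "g \<in> dual_space (X n)"
  shows "(\<lambda>x\<in>carrier Y. g (x n)) \<in> dual_space Y"
proof (rule Y.dual_spaceI)
  show "norm (g (x n)) \<le> dual_norm (X n) g * vnorm Y x" if "x \<in> carrier Y" for x
  proof -
    have "norm (g (x n)) \<le> dual_norm (X n) g * vnorm (X n) (x n)"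
      using that by (intro Xn.norm_le_dual_norm g) (auto simp: carrier_iff)
    also have "\<dots> \<le> dual_norm (X n) g * vnorm Y x"
      by (intro mult_left_mono coord_contraction that Xn.dual_norm_nonneg g)
    finally show ?thesis .
  qed
qed (auto simp: carrier_iff add_eq smult_eq Xn.dual_add[OF g] Xn.dual_smult[OF g])

lemma dual_cutoff_finite:
  assumes f: "f \<in> dual_space Y" and "finite F" and x: "\<And>k. x k \<in> carrier (X k)"
  shows "f (cutoff X F x) = (\<Sum>k\<in>F. coord_proj X k f (x k))"
  using \<open>finite F\<close>
proof (induction F rule: finite_induct)
  case empty
  have "cutoff X {} x = \<zero>\<^bsub>Y\<^esub>" by (simp add: cutoff_def zero_eq)
  then show ?case by (simp add: Y.dual_zero[OF f])
next
  case (insert n F)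
  have "cutoff X {n} x = coord_inj X n (x n)"
    by (auto simp: cutoff_def coord_inj_def)
  moreover have "cutoff X (insert n F) x = cutoff X {n} x \<oplus>\<^bsub>Y\<^esub> cutoff X F x"
    using cutoff_Un[of x "{n}" F] x insert by simp
  ultimately show ?case
    using insert x by (simp add: Y.dual_add[OF f] cutoff_finite_closed coord_inj_closed coord_proj_apply)
qed

text \<open>
  The first half of the duality. For finite \<open>S\<close> the value of \<open>f\<close> is the sum of the values of its
  coordinates, and Hoelder's inequality applies. For general \<open>S\<close>, the part of \<open>x\<close> beyond \<open>n\<close> has
  norm tending to zero, and \<open>f\<close> is continuous.
\<close>

lemma dual_cutoff_le:
  assumes f: "f \<in> dual_space Y" and x: "x \<in> carrier Y" and D: "0 \<le> D"
    and sums: "\<And>F. \<lbrakk>finite F; F \<subseteq> S\<rbrakk> \<Longrightarrow> (\<Sum>k\<in>F. coord_norm k f powr q) \<le> D powr q"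
  shows "norm (f (cutoff X S x)) \<le> D * vnorm Y x"
proof -
  have xk: "x k \<in> carrier (X k)" for k using x by (simp add: carrier_iff)
  have head: "norm (f (cutoff X F x)) \<le> D * vnorm Y x" if F: "finite F" "F \<subseteq> S" for F
  proof -
    have "norm (f (cutoff X F x)) \<le> (\<Sum>k\<in>F. norm (coord_proj X k f (x k)))"
      unfolding dual_cutoff_finite[OF f F(1) xk] by (rule norm_sum)
    also have "\<dots> \<le> (\<Sum>k\<in>F. coord_norm k f * vnorm (X k) (x k))"
      by (intro sum_mono Xn.norm_le_dual_norm coord_proj_in_dual f xk)
    also have "\<dots> \<le> (\<Sum>k\<in>F. coord_norm k f powr q) powr (1 / q) * vnorm Y x"
      unfolding vnorm_eq using x F
      by (intro Hoelder) (auto simp: carrier_iff coord_norm_nonneg[OF f] Xn.gauge_nonneg)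
    also have "\<dots> \<le> (D powr q) powr (1 / q) * vnorm Y x"
      using q_pos F by (intro mult_right_mono powr_mono2 sums Y.gauge_nonneg x) (auto intro: sum_nonneg)
    also have "(D powr q) powr (1 / q) = D" using q_pos D by (simp add: powr_powr)
    finally show ?thesis .
  qed
  let ?tail = "\<lambda>n. vnorm Y (cutoff X {n..} x)"
  have "norm (f (cutoff X S x)) \<le> D * vnorm Y x + dual_norm Y f * ?tail n" for n
  proof -
    have "S = (S \<inter> {..<n}) \<union> (S \<inter> {n..})" "(S \<inter> {..<n}) \<inter> (S \<inter> {n..}) = {}" by auto
    then have "cutoff X S x = cutoff X (S \<inter> {..<n}) x \<oplus>\<^bsub>Y\<^esub> cutoff X (S \<inter> {n..}) x"
      using cutoff_Un[of x "S \<inter> {..<n}" "S \<inter> {n..}", OF xk] by simp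
    then have "f (cutoff X S x) = f (cutoff X (S \<inter> {..<n}) x) + f (cutoff X (S \<inter> {n..}) x)"
      by (simp add: Y.dual_add[OF f] cutoff_closed x)
    also have "norm \<dots> \<le> norm (f (cutoff X (S \<inter> {..<n}) x)) + norm (f (cutoff X (S \<inter> {n..}) x))"
      by (rule norm_triangle_ineq)
    also have "norm (f (cutoff X (S \<inter> {n..}) x)) \<le> dual_norm Y f * vnorm Y (cutoff X (S \<inter> {n..}) x)"
      by (intro Y.norm_le_dual_norm f cutoff_closed x)
    also have "\<dots> \<le> dual_norm Y f * ?tail n"
      by (intro mult_left_mono cutoff_mono x Y.dual_norm_nonneg f) auto
    finally show ?thesis using head[of "S \<inter> {..<n}"] by simp
  qed
  moreover have "(\<lambda>n. D * vnorm Y x + dual_norm Y f * ?tail n) \<longlonglongrightarrow> D * vnorm Y x + dual_norm Y f * 0"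
  proof (intro tendsto_add tendsto_mult tendsto_const)
    have "vnorm (X k) (cutoff X {n..} x k) = (if k < n then 0 else vnorm (X k) (x k))" for n k
      by (simp add: cutoff_def Xn.gauge_zero)
    then show "?tail \<longlonglongrightarrow> 0"
      using N_tail[of "\<lambda>n. vnorm (X n) (x n)"] x by (simp add: vnorm_eq carrier_iff Xn.gauge_nonneg)
  qed
  ultimately show ?thesis using LIMSEQ_le_const by (metis (no_types, lifting) add_0_right mult_zero_right)
qed

text \<open>
  The second half of the duality. In each coordinate one takes a vector that nearly norms \<open>P\<^sub>k f\<close> and
  scales it by the extremal sequence for the weights \<open>d\<^sub>k f\<close>. The result lies in the unit
  ball of the direct sum, and \<open>f\<close> takes on it nearly the \<open>q\<close>-norm of the weights as its value.
\<close>

lemma sum_coord_norm_le: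
  assumes f: "f \<in> dual_space Y" and F: "finite F" and C: "0 \<le> C"
    and bound: "\<And>x. \<lbrakk>x \<in> carrier Y; cutoff X F x = x; vnorm Y x \<le> 1\<rbrakk> \<Longrightarrow> norm (f x) \<le> C"
  shows "(\<Sum>k\<in>F. coord_norm k f powr q) \<le> C powr q"
proof -
  let ?t = "\<lambda>k. coord_norm k f"
  obtain s where s: "\<And>k. 0 \<le> s k" "\<And>k. k \<notin> F \<Longrightarrow> s k = 0" "N s \<le> 1"
    "(\<Sum>k\<in>F. ?t k powr q) powr (1 / q) = (\<Sum>k\<in>F. ?t k * s k)"
    using extremal[OF F, of ?t] coord_norm_nonneg[OF f] by blast
  have "(\<Sum>k\<in>F. ?t k * s k) \<le> C"
  proof (rule field_le_mult_one_interval)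
    fix \<theta> :: real assume \<theta>: "0 < \<theta>" "\<theta> < 1"
    have "\<forall>k. \<exists>u\<in>carrier (X k). vnorm (X k) u \<le> 1 \<and>
      coord_proj X k f u = of_real (norm (coord_proj X k f u)) \<and> \<theta> * ?t k \<le> norm (coord_proj X k f u)"
      using \<theta> by (intro allI Xn.dual_norm_attained_upto coord_proj_in_dual f)
    then obtain u where u: "\<And>k. u k \<in> carrier (X k)" "\<And>k. vnorm (X k) (u k) \<le> 1"
      "\<And>k. coord_proj X k f (u k) = of_real (norm (coord_proj X k f (u k)))"
      "\<And>k. \<theta> * ?t k \<le> norm (coord_proj X k f (u k))"
      by metis
    let ?r = "\<lambda>k. norm (coord_proj X k f (u k))"
    define w where "w k = of_real (s k) \<odot>\<^bsub>X k\<^esub> u k" for k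
    have w: "w k \<in> carrier (X k)" for k using u by (simp add: w_def Xn.smult_closed)
    define x where "x = cutoff X F w"
    have xs: "x k \<in> carrier (X k)" "vnorm (X k) (x k) \<le> s k" "L s" for k
    proof -
      show "x k \<in> carrier (X k)" using w by (simp add: x_def cutoff_def)
      show "vnorm (X k) (x k) \<le> s k"
        using u(1,2)[of k] s(1)[of k]
        by (auto simp: x_def cutoff_def w_def Xn.gauge_zero Xn.gauge_smult mult_left_le)
      show "L s" using F s(2) by (rule L_finite)
    qed
    have "x \<in> carrier Y" "vnorm Y x \<le> N s"
      by (rule carrier_if_dominated[OF xs])+
    moreover have "cutoff X F x = x" by (auto simp: x_def cutoff_def)
    ultimately have "norm (f x) \<le> C" using bound s(3) by simp
    moreover have "f x = of_real (\<Sum>k\<in>F. s k * ?r k)"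
    proof -
      have "coord_proj X k f (w k) = of_real (s k) * coord_proj X k f (u k)" for k
        using u(1) by (simp add: w_def Xn.dual_smult[OF coord_proj_in_dual[OF f]])
      then have "coord_proj X k f (w k) = of_real (s k * ?r k)" for k
        using u(3)[of k] by simp
      then show ?thesis by (simp add: x_def dual_cutoff_finite[OF f F w])
    qed
    ultimately have "\<bar>\<Sum>k\<in>F. s k * ?r k\<bar> \<le> C" by (simp only: norm_of_real)
    moreover have "\<theta> * (\<Sum>k\<in>F. ?t k * s k) \<le> (\<Sum>k\<in>F. s k * ?r k)"
    proof -
      have "s k * (\<theta> * ?t k) \<le> s k * ?r k" for k by (rule mult_left_mono[OF u(4) s(1)])
      then have "(\<Sum>k\<in>F. s k * (\<theta> * ?t k)) \<le> (\<Sum>k\<in>F. s k * ?r k)" by (rule sum_mono)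
      then show ?thesis by (simp add: sum_distrib_left mult.assoc mult.left_commute mult.commute)
    qed
    ultimately show "\<theta> * (\<Sum>k\<in>F. ?t k * s k) \<le> C" by linarith
  qed
  then have "(\<Sum>k\<in>F. ?t k powr q) powr (1 / q) \<le> C" by (simp only: s(4))
  then have "((\<Sum>k\<in>F. ?t k powr q) powr (1 / q)) powr q \<le> C powr q"
    using q_pos by (intro powr_mono2) auto
  then show ?thesis using q_pos by (simp add: powr_powr sum_nonneg)
qed

lemma sum_coord_norm_le_dual_norm:
  assumes "f \<in> dual_space Y" "finite F"
  shows "(\<Sum>k\<in>F. coord_norm k f powr q) \<le> dual_norm Y f powr q"
  using assms by (intro sum_coord_norm_le Y.dual_norm_nonneg Y.dual_norm_upper)

section \<open>Weakly summable sequences and (V) sets in direct sums\<close>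

lemma weakly_summable_coord_inj:
  assumes x: "weakly_summable q (X n) x"
  shows "weakly_summable q Y (\<lambda>j. coord_inj X n (x j))"
  unfolding weakly_summable_def
proof (intro conjI allI ballI)
  have xc: "x j \<in> carrier (X n)" for j using x by (simp add: weakly_summable_def)
  then show "coord_inj X n (x j) \<in> carrier Y" for j by (rule coord_inj_closed)
  fix f assume "f \<in> dual_space Y"
  then have "summable (\<lambda>j. norm (coord_proj X n f (x j)) powr q)"
    using x coord_proj_in_dual unfolding weakly_summable_def by blast
  then show "summable (\<lambda>j. norm (f (coord_inj X n (x j))) powr q)"
    by (simp add: coord_proj_apply xc)
qed

lemma weakly_summable_coord:
  assumes x: "weakly_summable q Y x"
  shows "weakly_summable q (X n) (\<lambda>j. x j n)"
  unfolding weakly_summable_def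
proof (intro conjI allI ballI)
  have xc: "x j \<in> carrier Y" for j using x by (simp add: weakly_summable_def)
  then show "x j n \<in> carrier (X n)" for j by (simp add: carrier_iff)
  fix g assume "g \<in> dual_space (X n)"
  then have "summable (\<lambda>j. norm ((\<lambda>y\<in>carrier Y. g (y n)) (x j)) powr q)"
    using x coord_functional_in_dual unfolding weakly_summable_def by blast
  then show "summable (\<lambda>j. norm (g (x j n)) powr q)" by (simp add: xc)
qed

lemma dual_bounded_coord_proj:
  assumes "dual_bounded Y A"
  shows "dual_bounded (X n) (coord_proj X n ` A)"
  using assms unfolding dual_bounded_def
  by (auto intro!: coord_proj_in_dual) (meson coord_norm_le order_trans subsetD)

lemma V_set_coord_proj:
  assumes "V_set q Y A"
  shows "V_set q (X n) (coord_proj X n ` A)"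
  unfolding V_set_iff
proof (intro conjI allI impI)
  show "dual_bounded (X n) (coord_proj X n ` A)"
    using assms by (intro dual_bounded_coord_proj) (simp add: V_set_def)
  fix x and \<epsilon> :: real assume x: "weakly_summable q (X n) x" and "0 < \<epsilon>"
  then have "\<exists>j0. \<forall>j\<ge>j0. \<forall>f\<in>A. norm (f (coord_inj X n (x j))) \<le> \<epsilon>"
    using assms weakly_summable_coord_inj unfolding V_set_iff by blast
  moreover have "x j \<in> carrier (X n)" for j using x by (simp add: weakly_summable_def)
  ultimately show "\<exists>j0. \<forall>j\<ge>j0. \<forall>g\<in>coord_proj X n ` A. norm (g (x j)) \<le> \<epsilon>"
    by (simp add: coord_proj_apply)
qed

text \<open>
  By the two halves of the duality, \<open>\<bar>f x\<^sub>j\<bar>\<^sup>q\<close> is at most the sum of \<open>(d\<^sub>k f)\<^sup>q\<close> over the \<open>j\<close>-th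
  block, and over disjoint blocks these sums together stay below the \<open>q\<close>-th power of the norm of \<open>f\<close>.
\<close>

lemma weakly_summable_blocks:
  assumes x: "\<And>j. x j \<in> carrier Y" "\<And>j. vnorm Y (x j) \<le> 1"
    and supp: "\<And>j. cutoff X (B j) (x j) = x j"
    and B: "\<And>j. finite (B j)" "\<And>i j. i \<noteq> j \<Longrightarrow> B i \<inter> B j = {}"
  shows "weakly_summable q Y x"
  unfolding weakly_summable_def
proof (intro conjI allI ballI x)
  fix f assume f: "f \<in> dual_space Y"
  let ?s = "\<lambda>j. \<Sum>k\<in>B j. coord_norm k f powr q"
  have le: "norm (f (x j)) powr q \<le> ?s j" for j
  proof -
    have s: "0 \<le> ?s j" by (intro sum_nonneg) simp
    have "norm (f (cutoff X (B j) (x j))) \<le> ?s j powr (1 / q) * vnorm Y (x j)"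
      using q_pos s B(1) by (intro dual_cutoff_le f x) (auto simp: powr_powr intro!: sum_mono2)
    also have "\<dots> \<le> ?s j powr (1 / q)" using x(2) by (intro mult_left_le) auto
    finally have "norm (f (x j)) powr q \<le> (?s j powr (1 / q)) powr q"
      using q_pos by (intro powr_mono2) (auto simp: supp)
    then show ?thesis using q_pos s by (simp add: powr_powr)
  qed
  show "summable (\<lambda>j. norm (f (x j)) powr q)"
  proof (rule bounded_imp_summable)
    fix n
    have "(\<Sum>j\<le>n. norm (f (x j)) powr q) \<le> (\<Sum>j\<le>n. ?s j)" by (intro sum_mono le)
    also have "\<dots> = (\<Sum>k\<in>(\<Union>j\<in>{..n}. B j). coord_norm k f powr q)"
      by (intro sum.UNION_disjoint[symmetric]) (use B in auto)
    also have "\<dots> \<le> dual_norm Y f powr q"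
      using B(1) by (intro sum_coord_norm_le_dual_norm f) auto
    finally show "(\<Sum>j\<le>n. norm (f (x j)) powr q) \<le> dual_norm Y f powr q" .
  qed simp
qed

definition uniformly_small_tails :: "((nat \<Rightarrow> 'a) \<Rightarrow> 'k) set \<Rightarrow> bool" where
  "uniformly_small_tails A \<longleftrightarrow> (\<forall>\<epsilon>>0. \<exists>n. \<forall>f\<in>A. \<forall>F. finite F \<and> F \<subseteq> {n..} \<longrightarrow>
     (\<Sum>k\<in>F. coord_norm k f powr q) \<le> \<epsilon>)"

lemma uniformly_small_tails_iff:
  "uniformly_small_tails A \<longleftrightarrow>
    (\<lambda>n. SUP f\<in>A. \<Sum>k. ennreal (coord_norm (n + k) f powr q)) \<longlonglongrightarrow> 0"
proof -
  let ?T = "\<lambda>f n. \<Sum>k. ennreal (coord_norm (n + k) f powr q)"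
  have fin: "?T f n \<le> ennreal \<epsilon> \<longleftrightarrow>
      (\<forall>F. finite F \<and> F \<subseteq> {n..} \<longrightarrow> (\<Sum>k\<in>F. coord_norm k f powr q) \<le> \<epsilon>)" if "0 < \<epsilon>" for f n \<epsilon>
    using that by (intro suminf_ennreal_le_iff) auto
  then have "uniformly_small_tails A \<longleftrightarrow> (\<forall>\<epsilon>>0. \<exists>n. \<forall>f\<in>A. ?T f n \<le> ennreal \<epsilon>)"
    unfolding uniformly_small_tails_def by simp
  also have "\<dots> \<longleftrightarrow> (\<forall>\<epsilon>>0. \<exists>n0. \<forall>n\<ge>n0. \<forall>f\<in>A. ?T f n \<le> ennreal \<epsilon>)"
  proof -
    have "?T f n \<le> ennreal \<epsilon>" if "?T f n0 \<le> ennreal \<epsilon>" "n0 \<le> n" "0 < \<epsilon>" for f n0 n \<epsilon>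
    proof -
      have "{n..} \<subseteq> {n0..}" using that by simp
      then show ?thesis using that(1) unfolding fin[OF that(3)] by (meson subset_trans)
    qed
    then show ?thesis by (meson order_refl)
  qed
  finally show ?thesis by (simp only: tendsto_SUP_ennreal_zero_iff)
qed

text \<open>
  Otherwise infinitely many disjoint blocks carry a fixed amount of the \<open>q\<close>-norm of some
  functional in \<open>A\<close>. Vectors of the unit ball on which these functionals are large, supported in the blocks, form a weakly summable sequence that
  violates the (V) property.
\<close>

lemma V_set_imp_uniformly_small_tails:
  assumes A: "V_set q Y A"
  shows "uniformly_small_tails A"
proof (rule ccontr)
  have dual: "f \<in> dual_space Y" if "f \<in> A" for f
    using A that by (auto simp: V_set_def dual_bounded_def)
  assume "\<not> uniformly_small_tails A"
  then have "\<exists>\<epsilon>>0. \<forall>n. \<exists>f\<in>A. \<exists>F. finite F \<and> F \<subseteq> {n..} \<and> \<not> (\<Sum>k\<in>F. coord_norm k f powr q) \<le> \<epsilon>"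
    unfolding uniformly_small_tails_def by simp
  then obtain \<epsilon> where \<epsilon>: "0 < \<epsilon>" and
    large: "\<forall>n. \<exists>f\<in>A. \<exists>F. finite F \<and> F \<subseteq> {n..} \<and> \<not> (\<Sum>k\<in>F. coord_norm k f powr q) \<le> \<epsilon>"
    by blast
  define Q where "Q n f F \<longleftrightarrow> f \<in> A \<and> finite F \<and> F \<subseteq> {n..} \<and>
    \<not> (\<Sum>k\<in>F. coord_norm k f powr q) \<le> \<epsilon>" for n f F
  have "\<forall>n. \<exists>f F. Q n f F" using large unfolding Q_def by blast
  then obtain f F where "\<And>n. Q n (f n) (F n)" by metis
  then have fF: "f n \<in> A" "finite (F n)" "F n \<subseteq> {n..}"
    "\<not> (\<Sum>k\<in>F n. coord_norm k (f n) powr q) \<le> \<epsilon>" for n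
    by (simp_all add: Q_def)
  \<comment> \<open>The next block is searched for only beyond the end of the previous one, so the blocks \<open>F (r j)\<close> are disjoint.\<close>
  define r where "r = rec_nat 0 (\<lambda>_ n. Suc (Max (insert n (F n))))"
  have r_Suc: "r (Suc j) = Suc (Max (insert (r j) (F (r j))))" for j by (simp add: r_def)
  have r: "r j < r (Suc j)" "F (r j) \<subseteq> {r j..<r (Suc j)}" for j
    using fF(2,3)[of "r j"] unfolding r_Suc by (auto simp: less_Suc_eq_le)
  have "strict_mono r" using r(1) by (rule strict_mono_Suc_iff[THEN iffD2, rule_format])
  have disj: "F (r i) \<inter> F (r j) = {}" if "i < j" for i j
  proof -
    have "r (Suc i) \<le> r j" using \<open>strict_mono r\<close> that by (simp add: strict_mono_less_eq Suc_le_eq)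
    then show ?thesis using r(2)[of i] r(2)[of j] by fastforce
  qed
  have "F (r i) \<inter> F (r j) = {}" if "i \<noteq> j" for i j
    using disj[of i j] disj[of j i] that by (cases "i < j") (simp_all add: Int_commute)
  have "\<exists>x. x \<in> carrier Y \<and> cutoff X (F n) x = x \<and> vnorm Y x \<le> 1 \<and> \<epsilon> powr (1 / q) < norm (f n x)" for n
  proof (rule ccontr)
    assume "\<not> ?thesis"
    then have "(\<Sum>k\<in>F n. coord_norm k (f n) powr q) \<le> (\<epsilon> powr (1 / q)) powr q"
      by (intro sum_coord_norm_le dual fF) (auto simp: not_less)
    then show False using fF(4)[of n] \<epsilon> q_pos by (simp add: powr_powr)
  qed
  then obtain x where x: "\<And>n. x n \<in> carrier Y" "\<And>n. cutoff X (F n) (x n) = x n"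
    "\<And>n. vnorm Y (x n) \<le> 1" "\<And>n. \<epsilon> powr (1 / q) < norm (f n (x n))"
    by metis
  have "weakly_summable q Y (\<lambda>j. x (r j))"
    by (rule weakly_summable_blocks[where B = "\<lambda>j. F (r j)"]) fact+
  moreover have "0 < \<epsilon> powr (1 / q)" using \<epsilon> by simp
  ultimately obtain j where "\<forall>f\<in>A. norm (f (x (r j))) \<le> \<epsilon> powr (1 / q)"
    using A unfolding V_set_iff by blast
  then show False using fF(1) x(4)[of "r j"] by (meson not_le)
qed

text \<open>
  A functional in \<open>A\<close> is split at an index \<open>n\<close> beyond which its tail functional has norm at most \<open>D\<close>
  for all members of \<open>A\<close> at once. Uniform boundedness of the evaluations at \<open>x\<^sub>j\<close> controls the tail
  functionals, and the coordinate hypotheses control the finitely many coordinates before \<open>n\<close>.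
\<close>

lemma V_set_if_uniformly_small_tails:
  assumes A: "dual_bounded Y A"
    and coords: "\<And>n. V_set q (X n) (coord_proj X n ` A)"
    and tails: "uniformly_small_tails A"
  shows "V_set q Y A"
  unfolding V_set_iff
proof (intro conjI allI impI A)
  fix x and \<epsilon> :: real assume x: "weakly_summable q Y x" and \<epsilon>: "0 < \<epsilon>"
  have dual: "f \<in> dual_space Y" if "f \<in> A" for f
    using A that by (auto simp: dual_bounded_def)
  have xc: "x j \<in> carrier Y" for j using x by (simp add: weakly_summable_def)
  then have xk: "x j k \<in> carrier (X k)" for j k by (simp add: carrier_iff)
  have "\<exists>B. \<forall>j. norm (f (x j)) \<le> B" if "f \<in> dual_space Y" for f
  proof -
    have "summable (\<lambda>j. norm (f (x j)) powr q)"
      using x that by (simp add: weakly_summable_def)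
    from summable_LIMSEQ_zero[OF this] obtain B where B: "\<And>j. norm (f (x j)) powr q \<le> B"
      by (metis Bseq_bdd_above bdd_above_def convergentI convergent_imp_Bseq rangeI)
    have "norm (f (x j)) \<le> B powr (1 / q)" for j
    proof -
      have "(norm (f (x j)) powr q) powr (1 / q) \<le> B powr (1 / q)"
        using B q_pos by (intro powr_mono2) auto
      then show ?thesis using q_pos by (simp add: powr_powr)
    qed
    then show ?thesis by blast
  qed
  then obtain M where M: "0 \<le> M" "\<And>f j. f \<in> dual_space Y \<Longrightarrow> norm (f (x j)) \<le> M * dual_norm Y f"
    using Y.weakly_bounded_imp_uniform[of x] xc by blast
  \<comment> \<open>\<open>M + 1\<close> instead of \<open>M\<close> keeps the denominator positive; the same device is used for \<open>\<delta>\<close>.\<close>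
  define D where "D = \<epsilon> / (2 * (M + 1))"
  have D: "0 < D" "M * D \<le> \<epsilon> / 2" using M(1) \<epsilon> by (auto simp: D_def field_simps)
  then have "0 < D powr q" by simp
  then obtain n where n: "\<And>f F. \<lbrakk>f \<in> A; finite F; F \<subseteq> {n..}\<rbrakk> \<Longrightarrow> (\<Sum>k\<in>F. coord_norm k f powr q) \<le> D powr q"
    using tails unfolding uniformly_small_tails_def by meson
  have tail: "norm (f (cutoff X {n..} (x j))) \<le> \<epsilon> / 2" if f: "f \<in> A" for f j
  proof -
    let ?g = "\<lambda>y\<in>carrier Y. f (cutoff X {n..} y)"
    have bound: "norm (f (cutoff X {n..} y)) \<le> D * vnorm Y y" if "y \<in> carrier Y" for y
      using D n[OF f] that by (intro dual_cutoff_le dual f) auto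
    have "?g \<in> dual_space Y"
    proof (rule Y.dual_spaceI[OF _ _ bound])
      have "cutoff X {n..} (y \<oplus>\<^bsub>Y\<^esub> z) = cutoff X {n..} y \<oplus>\<^bsub>Y\<^esub> cutoff X {n..} z" for y z
        by (auto simp: cutoff_def add_eq)
      then show "f (cutoff X {n..} (y \<oplus>\<^bsub>Y\<^esub> z)) = f (cutoff X {n..} y) + f (cutoff X {n..} z)"
        if "y \<in> carrier Y" "z \<in> carrier Y" for y z
        using that by (simp add: Y.dual_add[OF dual[OF f]] cutoff_closed)
      have "cutoff X {n..} (a \<odot>\<^bsub>Y\<^esub> y) = a \<odot>\<^bsub>Y\<^esub> cutoff X {n..} y" for a y
        by (auto simp: cutoff_def smult_eq Xn.smult_zero)
      then show "f (cutoff X {n..} (a \<odot>\<^bsub>Y\<^esub> y)) = a * f (cutoff X {n..} y)"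
        if "y \<in> carrier Y" for a y
        using that by (simp add: Y.dual_smult[OF dual[OF f]] cutoff_closed)
    qed
    then have "norm (?g (x j)) \<le> M * dual_norm Y ?g" by (rule M)
    also have "\<dots> \<le> M * D"
      using D bound by (intro mult_left_mono M Y.dual_norm_bound) auto
    finally show ?thesis using D xc by simp
  qed
  define \<delta> where "\<delta> = \<epsilon> / (2 * (real n + 1))"
  have \<delta>: "0 < \<delta>" "real n * \<delta> \<le> \<epsilon> / 2" using \<epsilon> by (auto simp: \<delta>_def field_simps)
  have "\<exists>j0. \<forall>j\<ge>j0. \<forall>f\<in>A. norm (coord_proj X k f (x j k)) \<le> \<delta>" for k
    using coords[of k] weakly_summable_coord[OF x, of k] \<delta>(1) unfolding V_set_iff by blast
  then obtain j0 where j0: "\<And>k j f. \<lbrakk>j0 k \<le> j; f \<in> A\<rbrakk> \<Longrightarrow> norm (coord_proj X k f (x j k)) \<le> \<delta>"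
    by metis
  have "norm (f (x j)) \<le> \<epsilon>" if j: "j \<ge> Max (j0 ` {..n})" and f: "f \<in> A" for j f
  proof -
    have "{..<n} \<union> {n..} = UNIV" "{..<n} \<inter> {n..} = {}" by auto
    then have "x j = cutoff X {..<n} (x j) \<oplus>\<^bsub>Y\<^esub> cutoff X {n..} (x j)"
      using cutoff_Un[of "x j" "{..<n}" "{n..}", OF xk] cutoff_UNIV[of "x j"]
      by simp
    then have "f (x j) = f (cutoff X {..<n} (x j)) + f (cutoff X {n..} (x j))"
      using Y.dual_add[OF dual[OF f]] cutoff_closed xc by metis
    then have "norm (f (x j)) \<le> norm (f (cutoff X {..<n} (x j))) + norm (f (cutoff X {n..} (x j)))"
      by (simp add: norm_triangle_ineq)
    also have "norm (f (cutoff X {..<n} (x j))) \<le> (\<Sum>k<n. norm (coord_proj X k f (x j k)))"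
      using dual_cutoff_finite[OF dual[OF f] _ xk] by (simp add: norm_sum)
    also have "\<dots> \<le> (\<Sum>k<n. \<delta>)"
    proof (intro sum_mono j0 f)
      fix k assume "k \<in> {..<n}"
      then have "j0 k \<le> Max (j0 ` {..n})" by (intro Max_ge) auto
      then show "j0 k \<le> j" using j by (rule order_trans)
    qed
    also have "\<dots> \<le> \<epsilon> / 2" using \<delta> by simp
    finally show ?thesis using tail[OF f, of j] by simp
  qed
  then show "\<exists>j0. \<forall>j\<ge>j0. \<forall>f\<in>A. norm (f (x j)) \<le> \<epsilon>" by blast
qed

theorem V_set_gauge_sum_iff:
  assumes "dual_bounded Y A"
  shows "V_set q Y A \<longleftrightarrow> (\<forall>n. V_set q (X n) (coord_proj X n ` A)) \<and>
    (\<lambda>n. SUP f\<in>A. \<Sum>k. ennreal (coord_norm (n + k) f powr q)) \<longlonglongrightarrow> 0"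
  using V_set_coord_proj V_set_imp_uniformly_small_tails V_set_if_uniformly_small_tails[OF assms]
  unfolding uniformly_small_tails_iff by blast

end

theorem theorem3p1:
  fixes X :: "nat \<Rightarrow> ('k :: {real_normed_field, banach}, 'a) normed_module"
    and Y :: "('k, nat \<Rightarrow> 'a) normed_module"
    and A :: "((nat \<Rightarrow> 'a) \<Rightarrow> 'k) set"
    and p q :: real
  assumes "\<And>n. banach_space_on (X n)"
    and "(1 < p \<and> 1 / p + 1 / q = 1 \<and> Y = lp_sum p X) \<or> (Y = c0_sum X \<and> q = 1)"
    and "dual_bounded Y A"
  shows "V_set q Y A \<longleftrightarrow>
    (\<forall>n. V_set q (X n) (coord_proj X n ` A)) \<and>
    (\<lambda>n. SUP f\<in>A. \<Sum>k. ennreal (dual_norm (X (n + k)) (coord_proj X (n + k) f) powr q)) \<longlonglongrightarrow> 0"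
proof -
  have "\<exists>L N. sequence_gauge L N q \<and> Y = gauge_sum L N X"
    using assms(2)
  proof (elim disjE conjE)
    assume "1 < p" "1 / p + 1 / q = 1" "Y = lp_sum p X"
    then show ?thesis
      using sequence_gauge_lp[of p q] unfolding lp_sum_def gauge_sum_def by blast
  next
    assume "Y = c0_sum X" "q = 1"
    then show ?thesis
      using sequence_gauge_c0 unfolding c0_sum_def gauge_sum_def by blast
  qed
  then obtain L N where L: "sequence_gauge L N q" and Y: "Y = gauge_sum L N X" by blast
  interpret gauge_sum_of_normed_spaces L N q X
    using L assms(1)
    by (auto simp: gauge_sum_of_normed_spaces_def gauge_sum_of_normed_spaces_axioms_def banach_space_on_def)
  show ?thesis using V_set_gauge_sum_iff assms(3) unfolding Y .
qed

end
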